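(* There is a polynomial-delay and polynomial-space algorithm which, given a graphic 2-XOR-CNF $\varphi$, enumerates the maximal signatures of $\varphi$ if and only if there is a polynomial-delay and polynomial-space algorithm which, given such $\varphi$, lists the maximal red-blue bipartite subgraphs of its underlying multigraph $G(\varphi)$.
   Context: A graphic 2-XOR-CNF is a conjunction $\varphi=C_1\land\dots\land C_m$ of pairwise distinct clauses, each of the form $x=y$ or $x\neq y$ (equations over $\mathrm{GF}(2)$). $G(\varphi)$ is the edge-bicolored multigraph on the variables of $\varphi$ with edges $e_1,\dots,e_m$, $e_j$ joining the two variables of $C_j$, blue if $C_j$ is $x\neq y$ and red if $C_j$ is $x=y$. A subgraph $H$ of an edge-bicolored multigraph $G$ (edge set $E(H)\subseteq E(G)$, vertex set containing the endpoints of its edges) is red-blue bipartite if there is a bipartition $(X,Y)$ of its vertex set such that the set of edges of $H$ with one endpoint in $X$ and the other in $Y$ is exactly the set $B(H)$ of blue edges of $H$; it is maximal if it is maximal under edge inclusion among red-blue bipartite subgraphs. Signatures: for an assignment $a$, $C_i(a)=1$ if $C_i$ holds and $0$ otherwise, signature $(C_1(a),\dots,C_m(a))$; maximal signatures are maximal under the bitwise order. Polynomial delay/space: delay between outputs and working memory polynomial in the input size. *)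

theory Defs
  imports "HOL-Computational_Algebra.Polynomial"
begin

section \<open>Graphic 2-XOR-CNFs and their signatures\<close>

datatype clause = Equal nat nat | Differ nat nat

type_synonym cnf = "clause list"

fun clause_vars :: "clause \<Rightarrow> nat set" where
  "clause_vars (Equal x y) = {x, y}"
| "clause_vars (Differ x y) = {x, y}"

fun is_differ :: "clause \<Rightarrow> bool" where
  "is_differ (Equal x y) = False"
| "is_differ (Differ x y) = True"

fun holds :: "(nat \<Rightarrow> bool) \<Rightarrow> clause \<Rightarrow> bool" where
  "holds a (Equal x y) \<longleftrightarrow> a x = a y"
| "holds a (Differ x y) \<longleftrightarrow> a x \<noteq> a y"

text \<open>Clauses are equations over GF(2), so \<open>x = y\<close> and \<open>y = x\<close> are the same clause: distinctness is
  that of the underlying equations.\<close>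

definition graphic :: "cnf \<Rightarrow> bool" where
  "graphic \<phi> \<longleftrightarrow>
     (\<forall>C \<in> set \<phi>. card (clause_vars C) = 2) \<and>
     distinct (map (\<lambda>C. (clause_vars C, is_differ C)) \<phi>)"

definition cnf_vars :: "cnf \<Rightarrow> nat set" where
  "cnf_vars \<phi> = (\<Union>C \<in> set \<phi>. clause_vars C)"

definition signature :: "cnf \<Rightarrow> (nat \<Rightarrow> bool) \<Rightarrow> bool list" where
  "signature \<phi> a = map (holds a) \<phi>"

definition signatures :: "cnf \<Rightarrow> bool list set" where
  "signatures \<phi> = range (signature \<phi>)"

definition bitwise_le :: "bool list \<Rightarrow> bool list \<Rightarrow> bool" where
  "bitwise_le s t \<longleftrightarrow> list_all2 (\<le>) s t"

definition maximal_signatures :: "cnf \<Rightarrow> bool list set" where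
  "maximal_signatures \<phi> =
     {s \<in> signatures \<phi>. \<forall>t \<in> signatures \<phi>. bitwise_le s t \<longrightarrow> t = s}"


section \<open>Edge-bicolored multigraphs\<close>

text \<open>The red edges are those in \<open>edges\<close> but not in \<open>blue\<close>.\<close>

record ('v, 'e) bicolored_multigraph =
  verts :: "'v set"
  edges :: "'e set"
  ends :: "'e \<Rightarrow> 'v set"
  blue :: "'e set"

definition graph_of :: "cnf \<Rightarrow> (nat, nat) bicolored_multigraph" where
  "graph_of \<phi> =
     \<lparr>verts = cnf_vars \<phi>,
      edges = {..<length \<phi>},
      ends = (\<lambda>j. clause_vars (\<phi> ! j)),
      blue = {j. j < length \<phi> \<and> is_differ (\<phi> ! j)}\<rparr>"

type_synonym ('v, 'e) subgraph = "'v set \<times> 'e set"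

definition is_subgraph :: "('v, 'e) bicolored_multigraph \<Rightarrow> ('v, 'e) subgraph \<Rightarrow> bool" where
  "is_subgraph G H \<longleftrightarrow>
     fst H \<subseteq> verts G \<and> snd H \<subseteq> edges G \<and> (\<forall>e \<in> snd H. ends G e \<subseteq> fst H)"

definition red_blue_bipartite ::
  "('v, 'e) bicolored_multigraph \<Rightarrow> ('v, 'e) subgraph \<Rightarrow> bool" where
  "red_blue_bipartite G H \<longleftrightarrow>
     (\<exists>X Y. X \<union> Y = fst H \<and> X \<inter> Y = {} \<and>
        {e \<in> snd H. \<exists>x \<in> X. \<exists>y \<in> Y. ends G e = {x, y}} = snd H \<inter> blue G)"

definition maximal_red_blue_bipartite_subgraphs ::
  "('v, 'e) bicolored_multigraph \<Rightarrow> ('v, 'e) subgraph set" where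
  "maximal_red_blue_bipartite_subgraphs G =
     {H. is_subgraph G H \<and> red_blue_bipartite G H \<and>
         (\<forall>H'. is_subgraph G H' \<and> red_blue_bipartite G H' \<longrightarrow> \<not> snd H \<subset> snd H')}"


section \<open>Turing machines with an output stream\<close>

text \<open>\<open>Aux\<close> supplies further working symbols; a machine uses finitely many of them.\<close>

datatype symbol = Blank | Bit bool | EqSym | NeqSym | Sep | Aux nat

datatype move = MoveL | Stay | MoveR

text \<open>In each step a machine may append one symbol to the solution it is currently writing (\<open>Put\<close>) or
  declare this solution complete (\<open>Done\<close>).\<close>

datatype emission = Silent | Put symbol | Done

record tm =
  tapes :: nat
  states :: "nat set"
  start :: nat
  alphabet :: "symbol set"
  delta :: "nat \<Rightarrow> symbol list \<Rightarrow> (nat \<times> (symbol \<times> move) list \<times> emission) option"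

definition wf_tm :: "tm \<Rightarrow> bool" where
  "wf_tm M \<longleftrightarrow>
     0 < tapes M \<and>
     finite (states M) \<and> start M \<in> states M \<and>
     finite (alphabet M) \<and> {Blank, EqSym, NeqSym, Sep} \<union> range Bit \<subseteq> alphabet M \<and>
     (\<forall>q ss q' acts out.
        q \<in> states M \<and> length ss = tapes M \<and> set ss \<subseteq> alphabet M \<and>
        delta M q ss = Some (q', acts, out) \<longrightarrow>
        q' \<in> states M \<and> length acts = tapes M \<and> fst ` set acts \<subseteq> alphabet M \<and>
        (\<forall>s. out = Put s \<longrightarrow> s \<in> alphabet M))"

text \<open>A two-way infinite tape, restricted to the cells visited so far or initially holding the input:
  the part left of the head (in reverse), the scanned cell, and the part right of the head.\<close>

datatype tape = Tape "symbol list" (scanned: symbol) "symbol list"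

fun tape_cells :: "tape \<Rightarrow> nat" where
  "tape_cells (Tape ls s rs) = length ls + 1 + length rs"

fun move_head :: "move \<Rightarrow> tape \<Rightarrow> tape" where
  "move_head Stay t = t"
| "move_head MoveL (Tape [] s rs) = Tape [] Blank (s # rs)"
| "move_head MoveL (Tape (l # ls) s rs) = Tape ls l (s # rs)"
| "move_head MoveR (Tape ls s []) = Tape (s # ls) Blank []"
| "move_head MoveR (Tape ls s (r # rs)) = Tape (s # ls) r rs"

fun act :: "symbol \<times> move \<Rightarrow> tape \<Rightarrow> tape" where
  "act (s', mv) (Tape ls s rs) = move_head mv (Tape ls s' rs)"

fun tape_of :: "symbol list \<Rightarrow> tape" where
  "tape_of [] = Tape [] Blank []"
| "tape_of (s # ss) = Tape [] s ss"

type_synonym config = "nat \<times> tape list"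

definition init_config :: "tm \<Rightarrow> symbol list \<Rightarrow> config" where
  "init_config M w = (start M, tape_of w # replicate (tapes M - 1) (tape_of []))"

definition step :: "tm \<Rightarrow> config \<Rightarrow> (config \<times> emission) option" where
  "step M c =
     (case delta M (fst c) (map scanned (snd c)) of
        None \<Rightarrow> None
      | Some (q', acts, out) \<Rightarrow> Some ((q', map2 act acts (snd c)), out))"

definition space :: "config \<Rightarrow> nat" where
  "space c = sum_list (map tape_cells (snd c))"

text \<open>\<open>halting_run M c os ss\<close>: started in \<open>c\<close>, the machine halts; \<open>os\<close> lists what its successive steps
  output, and \<open>ss\<close> the space of the successive configurations, including \<open>c\<close> and the final one. The
  output stream does not count as space.\<close>

inductive halting_run :: "tm \<Rightarrow> config \<Rightarrow> emission list \<Rightarrow> nat list \<Rightarrow> bool" for M where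
  halt: "step M c = None \<Longrightarrow> halting_run M c [] [space c]"
| step: "step M c = Some (c', out) \<Longrightarrow> halting_run M c' os ss \<Longrightarrow>
           halting_run M c (out # os) (space c # ss)"

text \<open>The completed solutions; the first argument is the part of the current solution already
  written.\<close>

fun solutions :: "symbol list \<Rightarrow> emission list \<Rightarrow> symbol list list" where
  "solutions w [] = []"
| "solutions w (Silent # os) = solutions w os"
| "solutions w (Put s # os) = solutions (w @ [s]) os"
| "solutions w (Done # os) = w # solutions [] os"

text \<open>The numbers of steps up to the first solution, between consecutive solutions, and from the last
  solution to termination; the first argument counts the steps since the last solution.\<close>

fun delays :: "nat \<Rightarrow> emission list \<Rightarrow> nat list" where
  "delays n [] = [n]"
| "delays n (out # os) =
     (if out = Done then Suc n # delays 0 os else delays (Suc n) os)"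

text \<open>An enumeration problem has a set of instances \<open>I\<close> and for each instance \<open>x\<close> a set \<open>S x\<close> of
  solutions; instances and solutions are written as words by \<open>enc\<close> and \<open>enc_sol x\<close>. Every solution
  has to be output exactly once.\<close>

definition poly_delay_poly_space_enumerable ::
  "'i set \<Rightarrow> ('i \<Rightarrow> symbol list) \<Rightarrow> ('i \<Rightarrow> 's set) \<Rightarrow> ('i \<Rightarrow> 's \<Rightarrow> symbol list) \<Rightarrow> bool" where
  "poly_delay_poly_space_enumerable I enc S enc_sol \<longleftrightarrow>
     (\<exists>M (p :: nat poly). wf_tm M \<and>
        (\<forall>x \<in> I. \<exists>os ss sols.
           halting_run M (init_config M (enc x)) os ss \<and>
           distinct sols \<and> set sols = S x \<and> solutions [] os = map (enc_sol x) sols \<and>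
           (\<forall>d \<in> set (delays 0 os). d \<le> poly p (length (enc x))) \<and>
           (\<forall>s \<in> set ss. s \<le> poly p (length (enc x)))))"


section \<open>Encodings\<close>

text \<open>Binary notation, most significant bit first.\<close>

fun bin :: "nat \<Rightarrow> symbol list" where
  "bin n = (if n < 2 then [Bit (odd n)] else bin (n div 2) @ [Bit (odd n)])"

declare bin.simps [simp del]

fun enc_clause :: "clause \<Rightarrow> symbol list" where
  "enc_clause (Equal x y) = bin x @ [EqSym] @ bin y @ [Sep]"
| "enc_clause (Differ x y) = bin x @ [NeqSym] @ bin y @ [Sep]"

definition enc_cnf :: "cnf \<Rightarrow> symbol list" where
  "enc_cnf \<phi> = concat (map enc_clause \<phi>)"

definition enc_signature :: "cnf \<Rightarrow> bool list \<Rightarrow> symbol list" where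
  "enc_signature \<phi> s = map Bit s"

text \<open>A subgraph of \<open>graph_of \<phi>\<close> is written as the list of its edges, each with its endpoints and its
  color. By \<open>maximal_subgraph_spanning\<close> below, the vertex set of a maximal red-blue bipartite subgraph
  need not be written.\<close>

definition enc_subgraph :: "cnf \<Rightarrow> (nat, nat) subgraph \<Rightarrow> symbol list" where
  "enc_subgraph \<phi> H = concat (map enc_clause (nths \<phi> (snd H)))"

lemma maximal_subgraph_spanning:
  assumes "graphic \<phi>"
    and "H \<in> maximal_red_blue_bipartite_subgraphs (graph_of \<phi>)"
  shows "fst H = verts (graph_of \<phi>)"
proof (rule ccontr)
  let ?G = "graph_of \<phi>"
  obtain V F where H: "H = (V, F)" by (cases H)
  have sub: "is_subgraph ?G (V, F)" and bip: "red_blue_bipartite ?G (V, F)"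
    and max: "\<And>H'. is_subgraph ?G H' \<Longrightarrow> red_blue_bipartite ?G H' \<Longrightarrow> \<not> F \<subset> snd H'"
    using assms(2) unfolding maximal_red_blue_bipartite_subgraphs_def H by (simp_all del: split_paired_All)
  assume "fst H \<noteq> verts ?G"
  then obtain v where v: "v \<in> cnf_vars \<phi>" "v \<notin> V"
    using sub by (auto simp: H is_subgraph_def graph_of_def)
  then obtain j where j: "j < length \<phi>" "v \<in> clause_vars (\<phi> ! j)"
    by (auto simp: cnf_vars_def in_set_conv_nth)
  have "card (clause_vars (\<phi> ! j)) = 2"
    using assms(1) j by (auto simp: graphic_def)
  then obtain p q where "clause_vars (\<phi> ! j) = {p, q}" "p \<noteq> q"
    by (auto simp: card_2_iff)
  then obtain u where u: "clause_vars (\<phi> ! j) = {u, v}" "u \<noteq> v"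
    using j(2) by (cases "v = p") (auto simp: insert_commute)
  have uG: "u \<in> cnf_vars \<phi>"
    using u j by (auto simp: cnf_vars_def intro!: bexI[of _ "\<phi> ! j"])
  have jF: "j \<notin> F"
    using sub v j by (auto simp: is_subgraph_def graph_of_def)
  have FV: "e < length \<phi>" "clause_vars (\<phi> ! e) \<subseteq> V" if "e \<in> F" for e
    using sub that by (auto simp: is_subgraph_def graph_of_def)
  obtain X Y where XY: "X \<union> Y = V" "X \<inter> Y = {}"
    and cut: "{e \<in> F. \<exists>x \<in> X. \<exists>y \<in> Y. clause_vars (\<phi> ! e) = {x, y}} =
              F \<inter> {j. j < length \<phi> \<and> is_differ (\<phi> ! j)}"
    using bip by (auto simp: red_blue_bipartite_def graph_of_def)
  define X0 where "X0 = (if u \<in> V then X else insert u X)"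
  define X' where "X' = (if (u \<in> X0) \<noteq> is_differ (\<phi> ! j) then insert v X0 else X0)"
  define V' where "V' = insert u (insert v V)"
  define Y' where "Y' = V' - X'"
  have X'V: "X' \<inter> V = X" "Y' \<inter> V = Y"
    using XY v(2) by (auto simp: X'_def X0_def Y'_def V'_def split: if_splits)
  have X'sub: "X' \<subseteq> V'"
    using XY by (auto simp: X'_def X0_def V'_def split: if_splits)
  have vX0: "v \<notin> X0"
    using XY u v by (auto simp: X0_def)
  have side: "(u \<in> X') \<noteq> (v \<in> X') \<longleftrightarrow> is_differ (\<phi> ! j)"
    using vX0 u(2) by (auto simp: X'_def)
  have old: "(\<exists>x \<in> X'. \<exists>y \<in> Y'. clause_vars (\<phi> ! e) = {x, y}) \<longleftrightarrow>
             (\<exists>x \<in> X. \<exists>y \<in> Y. clause_vars (\<phi> ! e) = {x, y})" if "e \<in> F" for e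
  proof -
    have "x \<in> V" if "clause_vars (\<phi> ! e) = {x, y} \<or> clause_vars (\<phi> ! e) = {y, x}" for x y
      using FV(2)[OF \<open>e \<in> F\<close>] that by auto
    then show ?thesis
      using X'V by (metis IntD1 IntI)
  qed
  have cut_iff: "(\<exists>x \<in> X. \<exists>y \<in> Y. clause_vars (\<phi> ! e) = {x, y}) \<longleftrightarrow> e < length \<phi> \<and> is_differ (\<phi> ! e)"
    if "e \<in> F" for e
    using cut that by blast
  have new: "(\<exists>x \<in> X'. \<exists>y \<in> Y'. clause_vars (\<phi> ! j) = {x, y}) \<longleftrightarrow> is_differ (\<phi> ! j)"
  proof -
    have "(\<exists>x \<in> X'. \<exists>y \<in> Y'. {u, v} = {x, y}) \<longleftrightarrow> u \<in> X' \<and> v \<in> Y' \<or> v \<in> X' \<and> u \<in> Y'"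
      by (auto simp: doubleton_eq_iff)
    also have "\<dots> \<longleftrightarrow> (u \<in> X') \<noteq> (v \<in> X')"
      by (auto simp: Y'_def V'_def)
    finally show ?thesis
      using side u by simp
  qed
  have "red_blue_bipartite ?G (V', insert j F)"
    unfolding red_blue_bipartite_def
  proof (intro exI conjI)
    show "X' \<union> Y' = fst (V', insert j F)" "X' \<inter> Y' = {}"
      using X'sub by (auto simp: Y'_def)
    show "{e \<in> snd (V', insert j F). \<exists>x \<in> X'. \<exists>y \<in> Y'. ends ?G e = {x, y}} =
          snd (V', insert j F) \<inter> blue ?G"
    proof (rule set_eqI)
      fix e
      show "e \<in> {e \<in> snd (V', insert j F). \<exists>x \<in> X'. \<exists>y \<in> Y'. ends ?G e = {x, y}} \<longleftrightarrow>
            e \<in> snd (V', insert j F) \<inter> blue ?G"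
        using old[of e] new j(1) cut_iff[of e]
        by (cases "e = j"; cases "e \<in> F") (simp_all add: graph_of_def)
    qed
  qed
  moreover have "is_subgraph ?G (V', insert j F)"
    using sub j v uG u by (auto simp: is_subgraph_def graph_of_def V'_def)
  ultimately have "\<not> F \<subset> insert j F"
    using max[of "(V', insert j F)"] by simp
  with jF show False by blast
qed

end

theory Submission
  imports Defs "HOL-Library.Nat_Bijection"
begin

text \<open>The clauses satisfied by an assignment form a red-blue bipartite spanning subgraph, and every
  red-blue bipartite subgraph is contained in one of this form; so maximal signatures correspond
  bijectively to maximal red-blue bipartite subgraphs, the signature being the indicator vector of the
  edge set. An enumerator for one problem becomes one for the other by adding two tapes: a copy of the
  input and a buffer that collects the solution being written. Each time the simulated machine
  completes a solution, the buffer is translated with the help of the copy, in time linear in the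
  input, and only the translation is output. From bits to edges this selects clauses of the copy; from
  edges to bits it matches the clauses of the copy against the buffer, which is unambiguous because
  the clauses are distinct.\<close>

section \<open>Runs and output streams\<close>

text \<open>Buffering decouples the two machines: the simulated one may spread the writing of a
  solution over its whole delay, whereas a translation wants the finished word and free movement of
  the heads. It is affordable because a step writes at most one symbol, so the buffered word is
  never longer than the delay bound, and this also keeps the translation time polynomial. Edge lists
  are written in clause order, so one left-to-right pass over the copy suffices in both directions.

  The technical obstacle is the space measure, which counts every cell ever visited. Erased buffer
  cells therefore remain on the tape and have to be tracked, and the tapes of the simulated machine
  have to be compared with tapes that carry a visited blank more than the original ones.\<close>

inductive run :: "('c \<Rightarrow> ('c \<times> emission) option) \<Rightarrow> 'c \<Rightarrow> emission list \<Rightarrow> 'c \<Rightarrow> bool" for f where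
  run_refl: "run f c [] c"
| run_step: "f c = Some (c', out) \<Longrightarrow> run f c' os c'' \<Longrightarrow> run f c (out # os) c''"

lemma run_trans: "run f c os c' \<Longrightarrow> run f c' os' c'' \<Longrightarrow> run f c (os @ os') c''"
  by (induction rule: run.induct) (auto intro: run_step)

lemma run_single: "f c = Some (c', out) \<Longrightarrow> run f c [out] c'"
  by (auto intro: run.intros)

fun puts :: "emission list \<Rightarrow> symbol list" where
  "puts [] = []"
| "puts (Put s # os) = s # puts os"
| "puts (_ # os) = puts os"

lemma puts_append [simp]: "puts (os @ os') = puts os @ puts os'"
  by (induction os rule: puts.induct) auto

lemma puts_replicate_Silent [simp]: "puts (replicate n Silent) = []"
  by (induction n) auto

lemma solutions_append:
  "Done \<notin> set os \<Longrightarrow> solutions w (os @ os') = solutions (w @ puts os) os'"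
  by (induction w os rule: solutions.induct) auto

lemma delays_append:
  "Done \<notin> set os \<Longrightarrow> delays n (os @ os') = delays (n + length os) os'"
  by (induction n os rule: delays.induct) auto

text \<open>The counter only grows until it is recorded as an entry of the list. This is what later
  bounds the buffer, which gains at most one symbol per counted step.\<close>

lemma delays_bound: "\<forall>d \<in> set (delays n os). d \<le> D \<Longrightarrow> n \<le> D"
  by (induction n os rule: delays.induct) (auto split: if_splits)


section \<open>Tapes\<close>

lemma act_scanned_Stay [simp]: "act (scanned t, Stay) t = t"
  by (cases t) auto

lemma act_scanned: "act (scanned t, mv) t = move_head mv t"
  by (cases t) auto

lemma tape_cells_act: "tape_cells (act u t) \<le> Suc (tape_cells t)"
  by (cases u; cases t; cases "snd u"; cases "case t of Tape ls s rs \<Rightarrow> ls";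
      cases "case t of Tape ls s rs \<Rightarrow> rs") auto

fun tape_symbols :: "tape \<Rightarrow> symbol set" where
  "tape_symbols (Tape ls s rs) = set ls \<union> {s} \<union> set rs"

lemma scanned_in_tape_symbols [simp]: "scanned t \<in> tape_symbols t"
  by (cases t) auto

lemma tape_symbols_act: "tape_symbols (act u t) \<subseteq> insert Blank (insert (fst u) (tape_symbols t))"
  by (cases u; cases t; cases "snd u"; cases "case t of Tape ls s rs \<Rightarrow> ls";
      cases "case t of Tape ls s rs \<Rightarrow> rs") auto

text \<open>Copying the input visits the blank cell behind it, so the simulated tapes agree with the original
  ones only up to one trailing blank cell.\<close>

definition padded :: "tape \<Rightarrow> tape \<Rightarrow> bool" where
  "padded t t' \<longleftrightarrow> (\<exists>ls s rs b. b \<le> 1 \<and> t = Tape ls s rs \<and> t' = Tape ls s (rs @ replicate b Blank))"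

lemma padded_refl: "padded t t"
  by (cases t) (auto simp: padded_def intro: exI[of _ 0])

lemma padded_scanned: "padded t t' \<Longrightarrow> scanned t' = scanned t"
  by (auto simp: padded_def)

lemma padded_cells: "padded t t' \<Longrightarrow> tape_cells t' \<le> Suc (tape_cells t)"
  by (auto simp: padded_def)

text \<open>A right move off the end of the shorter tape creates exactly the blank cell that the
  padding already supplies, so the padding vanishes there. Every other move leaves it alone; it
  never grows.\<close>

lemma padded_act:
  assumes "padded t t'"
  shows "padded (act u t) (act u t')"
proof -
  obtain ls s rs b where b: "b \<le> 1" "t = Tape ls s rs" "t' = Tape ls s (rs @ replicate b Blank)"
    using assms by (auto simp: padded_def)
  obtain s' mv where u: "u = (s', mv)" by (cases u)
  show ?thesis
  proof (cases mv)
    case MoveL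
    then show ?thesis using b u by (cases ls) (auto simp: padded_def)
  next
    case Stay
    then show ?thesis using b u by (auto simp: padded_def)
  next
    case MoveR
    show ?thesis
    proof (cases rs)
      case Nil
      then show ?thesis using b u MoveR by (cases b) (auto simp: padded_def)
    next
      case (Cons r rs')
      then show ?thesis using b u MoveR by (auto simp: padded_def)
    qed
  qed
qed

lemma list_all2_padded_cells:
  "list_all2 padded ts ts' \<Longrightarrow>
     sum_list (map tape_cells ts') \<le> sum_list (map tape_cells ts) + length ts"
  by (induction rule: list_all2_induct) (auto dest!: padded_cells)

text \<open>\<open>tape_at p q z\<close> holds the word \<open>p @ q\<close> between two blank cells, followed by \<open>z\<close> further blank
  cells; the head is on the first symbol after \<open>p\<close>. In \<open>tape_home q z\<close> the head is on the blank cell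
  to the left of the word \<open>q\<close>.\<close>

definition tape_at :: "symbol list \<Rightarrow> symbol list \<Rightarrow> nat \<Rightarrow> tape" where
  "tape_at p q z = Tape (rev p @ [Blank]) (hd (q @ [Blank])) (tl (q @ Blank # replicate z Blank))"

definition tape_home :: "symbol list \<Rightarrow> nat \<Rightarrow> tape" where
  "tape_home q z = Tape [] Blank (q @ Blank # replicate z Blank)"

lemma scanned_tape_at [simp]:
  "scanned (tape_at p [] z) = Blank" "scanned (tape_at p (a # q) z) = a"
  "scanned (tape_home q z) = Blank"
  by (auto simp: tape_at_def tape_home_def)

lemma move_tape_at [simp]:
  "move_head MoveR (tape_at p (a # q) z) = tape_at (p @ [a]) q z"
  "move_head MoveL (tape_at (p @ [a]) q z) = tape_at p (a # q) z"
  "move_head MoveL (tape_at [] q z) = tape_home q z"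
  "move_head MoveR (tape_home q z) = tape_at [] q z"
  by (cases q; auto simp: tape_at_def tape_home_def)+

lemma act_tape_at [simp]:
  "act (a, mv) (tape_at p (a # q) z) = move_head mv (tape_at p (a # q) z)"
  "act (Blank, mv) (tape_at p [] z) = move_head mv (tape_at p [] z)"
  "act (Blank, mv) (tape_home q z) = move_head mv (tape_home q z)"
  by (auto simp: tape_at_def tape_home_def)

text \<open>A write behind the word uses up a spare blank cell if there is one and lengthens the
  tape otherwise. As erasing turns a symbol back into a spare cell, word length plus spare cells is
  the high-water mark of the buffer.\<close>

lemma act_tape_at_write [simp]:
  "act (s, MoveR) (tape_at p [] 0) = tape_at (p @ [s]) [] 0"
  "act (s, MoveR) (tape_at p [] (Suc z)) = tape_at (p @ [s]) [] z"
  by (auto simp: tape_at_def)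

lemma act_tape_at_erase:
  "act (Blank, MoveL) (tape_at p [a] z) = move_head MoveL (tape_at p [] (Suc z))"
  by (cases p rule: rev_cases) (auto simp: tape_at_def)

lemma tape_cells_tape_at [simp]:
  "tape_cells (tape_at p q z) = length p + length q + z + 2"
  "tape_cells (tape_home q z) = length q + z + 2"
  by (cases q; auto simp: tape_at_def tape_home_def)+

text \<open>In contrast to \<open>tape_at\<close> there is no blank cell to the left: the run starts
  on the leftmost cell of the input, and copying must not add a cell in front of it.\<close>

definition input_at :: "symbol list \<Rightarrow> symbol list \<Rightarrow> tape" where
  "input_at p q = Tape (rev p) (hd (q @ [Blank])) (tl q)"

definition input_padded_at :: "symbol list \<Rightarrow> symbol list \<Rightarrow> tape" where
  "input_padded_at p q = Tape (rev p) (hd (q @ [Blank])) (tl (q @ [Blank]))"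

lemma input_at_simps [simp]:
  "scanned (input_at p (a # q)) = a" "scanned (input_at p []) = Blank"
  "act (a, MoveR) (input_at p (a # q)) = input_at (p @ [a]) q"
  "act (Blank, Stay) (input_at p []) = input_padded_at p []"
  by (cases q; auto simp: input_at_def input_padded_at_def)+

lemma input_padded_at_simps [simp]:
  "move_head MoveL (input_padded_at (p @ [a]) q) = input_padded_at p (a # q)"
  by (cases q) (auto simp: input_padded_at_def)

lemma input_at_Nil: "input_at [] w = tape_of w"
  by (cases w) (auto simp: input_at_def)

lemma padded_input: "padded (tape_of w) (input_padded_at [] w)"
proof (cases w)
  case Nil
  then show ?thesis by (simp add: input_padded_at_def padded_refl)
next
  case (Cons a r)
  then show ?thesis
    by (auto simp: input_padded_at_def padded_def intro!: exI[of _ 1])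
qed


section \<open>The control program\<close>

text \<open>It works on the input tape and two extra tapes: one keeps a copy of the input, the
  other buffers the solution being written by the simulated machine. States 1 to 3 copy the input and
  move both heads back; 4 and 5 rewind the buffer; 6, 9 and 10 are left to \<open>h\<close>, which translates the
  buffered solution and ends in state 7; 7 and 8 rewind the copy and erase the buffer. State 0 hands
  control to the simulated machine.\<close>

type_synonym translator = "nat \<Rightarrow> symbol \<Rightarrow> symbol \<Rightarrow> nat \<times> move \<times> move \<times> emission"

definition prog :: "translator \<Rightarrow> nat \<Rightarrow> symbol \<Rightarrow> symbol \<Rightarrow> symbol \<Rightarrow>
    nat \<times> (symbol \<times> move) \<times> (symbol \<times> move) \<times> (symbol \<times> move) \<times> emission" where
  "prog h a s x y =
    (if a = 1 then (2, (s, Stay), (x, MoveR), (y, MoveR), Silent)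
     else if a = 2 then
       (if s = Blank then (3, (s, Stay), (x, MoveL), (y, Stay), Silent)
        else (2, (s, MoveR), (s, MoveR), (y, Stay), Silent))
     else if a = 3 then
       (if x = Blank then (0, (s, Stay), (x, Stay), (y, Stay), Silent)
        else (3, (s, MoveL), (x, MoveL), (y, Stay), Silent))
     else if a = 4 then (5, (s, Stay), (x, Stay), (y, MoveL), Silent)
     else if a = 5 then
       (if y = Blank then (6, (s, Stay), (x, MoveR), (y, MoveR), Silent)
        else (5, (s, Stay), (x, Stay), (y, MoveL), Silent))
     else if a = 7 then
       (if x = Blank then (8, (s, Stay), (x, Stay), (y, Stay), Silent)
        else (7, (s, Stay), (x, MoveL), (y, Stay), Silent))
     else if a = 8 then
       (if y = Blank then (0, (s, Stay), (x, Stay), (y, MoveR), Done)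
        else (8, (s, Stay), (x, Stay), (Blank, MoveL), Silent))
     else (case h a x y of (a', mx, my, out) \<Rightarrow> (a', (s, Stay), (x, mx), (y, my), out)))"

text \<open>Control state 0 halts here because the simulated machine moves in it; a
  \<open>run\<close> of this function thus covers the control phase between two hand-overs. The tape
  \<open>t\<close> is the first tape of the simulated machine.\<close>

fun prog_step :: "translator \<Rightarrow> nat \<times> tape \<times> tape \<times> tape \<Rightarrow>
    ((nat \<times> tape \<times> tape \<times> tape) \<times> emission) option" where
  "prog_step h (a, t, x, y) =
    (if a = 0 then None
     else case prog h a (scanned t) (scanned x) (scanned y) of
       (a', u, v, w, out) \<Rightarrow> Some ((a', act u t, act v x, act w y), out))"

section \<open>Phases of the control program: copying, rewinding, erasing\<close>

lemma run_copy:
  assumes "Blank \<notin> set q"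
  shows "run (prog_step h) (2, input_at p q, tape_at p [] 0, y) (replicate (Suc (length q)) Silent)
           (3, input_padded_at (p @ q) [], move_head MoveL (tape_at (p @ q) [] 0), y)"
  using assms
proof (induction q arbitrary: p)
  case Nil
  then show ?case by (auto intro!: run_single simp: prog_def act_scanned)
next
  case (Cons a q)
  then show ?case by (auto intro!: run_step[OF _ Cons.IH[of "p @ [a]", simplified]] simp: prog_def act_scanned)
qed

text \<open>The input tape has no left marker. The head on the copy is one cell further left, so it
  reaches the blank in front of the copy exactly when the input head is back on its initial
  cell.\<close>

lemma run_rewind_input:
  assumes "Blank \<notin> set p"
  shows "run (prog_step h) (3, input_padded_at p q, move_head MoveL (tape_at p q 0), y)
           (replicate (Suc (length p)) Silent)
           (0, input_padded_at [] (p @ q), tape_home (p @ q) 0, y)"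
  using assms
proof (induction p arbitrary: q rule: rev_induct)
  case Nil
  then show ?case by (auto intro!: run_single simp: prog_def act_scanned)
next
  case (snoc a p)
  then show ?case by (auto intro!: run_step[OF _ snoc.IH[of "a # q", simplified]] simp: prog_def act_scanned)
qed

text \<open>One step creates the blank markers in front of the copy and the buffer; each of the two
  passes takes one step per symbol and one more on a blank.\<close>

lemma run_preparation:
  assumes "Blank \<notin> set w"
  shows "run (prog_step h) (1, tape_of w, tape_of [], tape_of []) (replicate (2 * length w + 3) Silent)
           (0, input_padded_at [] w, tape_home w 0, tape_at [] [] 0)"
proof -
  have 1: "run (prog_step h) (1, tape_of w, tape_of [], tape_of []) [Silent]
      (2, input_at [] w, tape_at [] [] 0, tape_at [] [] 0)"
    by (rule run_single) (simp add: prog_def input_at_Nil act_scanned tape_at_def)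
  note 2 = run_copy[OF assms, of h "[]" "tape_at [] [] 0"]
  note 3 = run_rewind_input[OF assms, of h "[]" "tape_at [] [] 0"]
  have "[Silent] @ replicate (Suc (length w)) Silent @ replicate (Suc (length w)) Silent =
      replicate (2 * length w + 3) Silent"
    by (simp only: replicate_add[symmetric] replicate_Suc[symmetric] append_Cons append_Nil)
      (simp add: numeral_3_eq_3 mult_2)
  then show ?thesis
    using run_trans[OF 1 run_trans[OF 2[unfolded append_Nil] 3[unfolded append_Nil2]]]
    by (simp only:)
qed

lemma run_rewind_buffer:
  assumes "Blank \<notin> set p"
  shows "run (prog_step h) (5, t, tape_home w 0, move_head MoveL (tape_at p q z))
           (replicate (Suc (length p)) Silent)
           (6, t, tape_at [] w 0, tape_at [] (p @ q) z)"
  using assms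
proof (induction p arbitrary: q rule: rev_induct)
  case Nil
  then show ?case by (auto intro!: run_single simp: prog_def act_scanned)
next
  case (snoc a p)
  then show ?case by (auto intro!: run_step[OF _ snoc.IH[of "a # q", simplified]] simp: prog_def act_scanned)
qed

lemma run_rewind_copy:
  assumes "Blank \<notin> set p"
  shows "run (prog_step h) (7, t, move_head MoveL (tape_at p q 0), y)
           (replicate (Suc (length p)) Silent)
           (8, t, tape_home (p @ q) 0, y)"
  using assms
proof (induction p arbitrary: q rule: rev_induct)
  case Nil
  then show ?case by (auto intro!: run_single simp: prog_def act_scanned)
next
  case (snoc a p)
  then show ?case by (auto intro!: run_step[OF _ snoc.IH[of "a # q", simplified]] simp: prog_def act_scanned)
qed

lemma run_erase_buffer:
  assumes "Blank \<notin> set p"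
  shows "run (prog_step h) (8, t, x, move_head MoveL (tape_at p [] z))
           (replicate (length p) Silent @ [Done]) (0, t, x, tape_at [] [] (z + length p))"
  using assms
proof (induction p arbitrary: z rule: rev_induct)
  case Nil
  then show ?case by (auto intro!: run_single simp: prog_def act_scanned)
next
  case (snoc a p)
  then show ?case
    by (auto intro!: run_step[OF _ snoc.IH[of "Suc z", simplified]] simp: prog_def act_scanned act_tape_at_erase)
qed

text \<open>The contract for the translator alone. Both heads end one cell to the left of the end of
  their words, where the leftward scans of states 7 and 8 begin. The number \<open>z\<close> is
  arbitrary because the spare cells depend on the solutions written before.\<close>

definition core_translates :: "translator \<Rightarrow> symbol list \<Rightarrow> symbol list \<Rightarrow> symbol list \<Rightarrow> nat \<Rightarrow> bool"
  where "core_translates h e w v K \<longleftrightarrow> (\<forall>t z. \<exists>os.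
     run (prog_step h) (6, t, tape_at [] e 0, tape_at [] w z) os
       (7, t, move_head MoveL (tape_at e [] 0), move_head MoveL (tape_at w [] z)) \<and>
     Done \<notin> set os \<and> puts os = v \<and> length os \<le> K)"

definition translates :: "translator \<Rightarrow> symbol list \<Rightarrow> nat \<Rightarrow> symbol list \<Rightarrow> symbol list \<Rightarrow> bool"
  where "translates h e K w v \<longleftrightarrow> (\<forall>t z. \<exists>os.
     run (prog_step h) (4, t, tape_home e 0, tape_at w [] z) (os @ [Done])
       (0, t, tape_home e 0, tape_at [] [] (z + length w)) \<and>
     Done \<notin> set os \<and> puts os = v \<and> length os \<le> K)"

text \<open>Besides the \<open>K\<close> steps of the translator there are two passes over the
  buffer, one over the copy, the step leaving state 4, and one step on a blank for each of the two
  rewinds. The closing \<open>Done\<close> is not counted.\<close>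

lemma core_translates_imp_translates:
  assumes "core_translates h e w v K" "Blank \<notin> set e" "Blank \<notin> set w"
  shows "translates h e (K + 2 * length w + length e + 3) w v"
  unfolding translates_def
proof (intro allI)
  fix t z
  obtain os where os: "run (prog_step h) (6, t, tape_at [] e 0, tape_at [] w z) os
       (7, t, move_head MoveL (tape_at e [] 0), move_head MoveL (tape_at w [] z))"
     "Done \<notin> set os" "puts os = v" "length os \<le> K"
    using assms(1) by (auto simp: core_translates_def)
  have 1: "run (prog_step h) (4, t, tape_home e 0, tape_at w [] z) [Silent]
      (5, t, tape_home e 0, move_head MoveL (tape_at w [] z))"
    by (rule run_single) (simp add: prog_def)
  note 2 = run_rewind_buffer[OF assms(3), of h t e "[]" z]
  note 3 = run_rewind_copy[OF assms(2), of h t "[]" "move_head MoveL (tape_at w [] z)"]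
  note 4 = run_erase_buffer[OF assms(3), of h t "tape_home e 0" z]
  let ?os = "[Silent] @ replicate (Suc (length w)) Silent @ os @
    replicate (Suc (length e)) Silent @ replicate (length w) Silent"
  have "run (prog_step h) (4, t, tape_home e 0, tape_at w [] z) (?os @ [Done])
       (0, t, tape_home e 0, tape_at [] [] (z + length w))"
    using run_trans[OF 1 run_trans[OF 2[simplified] run_trans[OF os(1) run_trans[OF 3[simplified] 4[simplified]]]]]
    by simp
  moreover have "Done \<notin> set ?os" "puts ?os = v" "length ?os \<le> K + 2 * length w + length e + 3"
    using os by (auto simp del: replicate.simps)
  ultimately show "\<exists>os. run (prog_step h) (4, t, tape_home e 0, tape_at w [] z) (os @ [Done])
       (0, t, tape_home e 0, tape_at [] [] (z + length w)) \<and>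
     Done \<notin> set os \<and> puts os = v \<and> length os \<le> K + 2 * length w + length e + 3"
    by blast
qed


section \<open>Composing a machine with a translator\<close>

text \<open>States are natural numbers, so \<open>prod_encode\<close> pairs the control state with
  the state of \<open>M\<close>, which stays frozen while the control program works. The two extra
  tapes come last: copy, then buffer. A \<open>Put\<close> of \<open>M\<close> is diverted to the
  buffer, a \<open>Done\<close> of \<open>M\<close> becomes a jump to control state 4.\<close>

definition comb_delta :: "tm \<Rightarrow> translator \<Rightarrow> nat \<Rightarrow> symbol list \<Rightarrow>
    (nat \<times> (symbol \<times> move) list \<times> emission) option" where
  "comb_delta M h n ss =
    (case prod_decode n of (a, q) \<Rightarrow>
      let ms = take (tapes M) ss; x = ss ! tapes M; y = ss ! Suc (tapes M) in
      if a = 0 then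
        (case delta M q ms of
           None \<Rightarrow> None
         | Some (q', acts, out) \<Rightarrow>
             Some (prod_encode (if out = Done then 4 else 0, q'),
               acts @ [(x, Stay), (case out of Put s \<Rightarrow> (s, MoveR) | _ \<Rightarrow> (y, Stay))], Silent))
      else
        (case prog h a (hd ms) x y of
           (a', u, v, w, out) \<Rightarrow>
             Some (prod_encode (a', q), u # map (\<lambda>s. (s, Stay)) (tl ms) @ [v, w], out)))"

definition comb :: "tm \<Rightarrow> translator \<Rightarrow> tm" where
  "comb M h =
    \<lparr>tapes = tapes M + 2, states = prod_encode ` ({..<11} \<times> states M),
     start = prod_encode (1, start M), alphabet = alphabet M, delta = comb_delta M h\<rparr>"

text \<open>Restricting output to bits and the symbol read on the copy keeps it inside the alphabet
  of \<open>M\<close>, whatever further symbols \<open>M\<close> has; the bound 11 matches the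
  control states 0 to 10.\<close>

definition wf_translator :: "translator \<Rightarrow> bool" where
  "wf_translator h \<longleftrightarrow> (\<forall>a x y a' mx my out. h a x y = (a', mx, my, out) \<longrightarrow>
     a' < 11 \<and> (\<forall>s. out = Put s \<longrightarrow> s \<in> insert x (range Bit)))"

lemma prog_wf:
  assumes "wf_translator h" "a < 11" "prog h a s x y = (a', u, v, w, out)"
    "Blank \<in> A" "range Bit \<subseteq> A" "s \<in> A" "x \<in> A" "y \<in> A"
  shows "a' < 11 \<and> fst u \<in> A \<and> fst v \<in> A \<and> fst w \<in> A \<and> (\<forall>s. out = Put s \<longrightarrow> s \<in> A)"
proof (cases "h a x y")
  case (fields b mx my o')
  then have "b < 11" "\<forall>s. o' = Put s \<longrightarrow> s \<in> insert x (range Bit)"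
    using assms(1) by (auto simp: wf_translator_def)
  moreover have "\<And>b. Bit b \<in> A" using assms(5) by auto
  ultimately show ?thesis
    using assms(3,4,6-) fields by (auto simp: prog_def split: if_splits)
qed

lemma wf_tm_delta:
  assumes "wf_tm M" "q \<in> states M" "length ss = tapes M" "set ss \<subseteq> alphabet M"
    and "delta M q ss = Some (q', acts, out)"
  shows "q' \<in> states M \<and> length acts = tapes M \<and> fst ` set acts \<subseteq> alphabet M \<and>
    (\<forall>s. out = Put s \<longrightarrow> s \<in> alphabet M)"
proof -
  have "\<forall>q ss q' acts out.
        q \<in> states M \<and> length ss = tapes M \<and> set ss \<subseteq> alphabet M \<and>
        delta M q ss = Some (q', acts, out) \<longrightarrow>
        q' \<in> states M \<and> length acts = tapes M \<and> fst ` set acts \<subseteq> alphabet M \<and>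
        (\<forall>s. out = Put s \<longrightarrow> s \<in> alphabet M)"
    using assms(1) unfolding wf_tm_def by (elim conjE)
  from this[rule_format, of q ss q' acts out] assms(2-) show ?thesis by blast
qed

lemma wf_comb:
  assumes M: "wf_tm M" and h: "wf_translator h"
  shows "wf_tm (comb M h)"
proof -
  have closed: "n' \<in> states (comb M h) \<and> length acts = tapes M + 2 \<and> fst ` set acts \<subseteq> alphabet M \<and>
      (\<forall>s. out = Put s \<longrightarrow> s \<in> alphabet M)"
    if n: "n \<in> states (comb M h)" and len: "length ss = tapes M + 2" and ss: "set ss \<subseteq> alphabet M"
      and d: "comb_delta M h n ss = Some (n', acts, out)" for n ss n' acts out
  proof -
    obtain a q where aq: "n = prod_encode (a, q)" "a < 11" "q \<in> states M"
      using n by (auto simp: comb_def)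
    let ?ms = "take (tapes M) ss"
    have xy: "ss ! tapes M \<in> alphabet M" "ss ! Suc (tapes M) \<in> alphabet M"
      using len ss by (auto simp: subset_iff)
    have ms: "length ?ms = tapes M" "set ?ms \<subseteq> alphabet M"
      using len ss set_take_subset[of "tapes M" ss] by auto
    show ?thesis
    proof (cases "a = 0")
      case True
      then obtain q' acts' o' where o': "delta M q ?ms = Some (q', acts', o')"
        "n' = prod_encode (if o' = Done then 4 else 0, q')"
        "acts = acts' @ [(ss ! tapes M, Stay),
           (case o' of Put s \<Rightarrow> (s, MoveR) | _ \<Rightarrow> (ss ! Suc (tapes M), Stay))]"
        "out = Silent"
        using d aq by (auto simp: comb_delta_def Let_def split: option.splits)
      have "q' \<in> states M \<and> length acts' = tapes M \<and> fst ` set acts' \<subseteq> alphabet M \<and>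
          (\<forall>s. o' = Put s \<longrightarrow> s \<in> alphabet M)"
        by (rule wf_tm_delta[OF M aq(3) ms o'(1)])
      then show ?thesis
        using o' xy by (auto simp: comb_def split: emission.splits)
    next
      case False
      obtain a' u v w o' where p: "prog h a (hd ?ms) (ss ! tapes M) (ss ! Suc (tapes M)) = (a', u, v, w, o')"
        by (metis prod_cases5)
      have ne: "?ms \<noteq> []" using ms(1) M by (auto simp: wf_tm_def)
      then have "hd ?ms \<in> alphabet M" using ms(2) hd_in_set by blast
      then have "a' < 11 \<and> fst u \<in> alphabet M \<and> fst v \<in> alphabet M \<and> fst w \<in> alphabet M \<and>
          (\<forall>s. o' = Put s \<longrightarrow> s \<in> alphabet M)"
        using M xy by (intro prog_wf[OF h aq(2) p]) (auto simp: wf_tm_def)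
      moreover have "set (tl ?ms) \<subseteq> alphabet M"
        using ms(2) ne by (metis list.set_sel(2) subset_code(1))
      moreover have "0 < tapes M" using M by (simp add: wf_tm_def)
      ultimately show ?thesis
        using False d aq p len by (auto simp: comb_delta_def Let_def comb_def image_image)
    qed
  qed
  have c: "tapes (comb M h) = tapes M + 2" "alphabet (comb M h) = alphabet M"
    "delta (comb M h) = comb_delta M h"
    by (simp_all add: comb_def)
  have m: "0 < tapes M" "finite (states M)" "start M \<in> states M" "finite (alphabet M)"
    "{Blank, EqSym, NeqSym, Sep} \<union> range Bit \<subseteq> alphabet M"
    using M by (simp_all add: wf_tm_def)
  have "finite (states (comb M h))" "start (comb M h) \<in> states (comb M h)"
    using m by (auto simp: comb_def)
  then show ?thesis
    unfolding wf_tm_def c using m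
    by (intro conjI) (simp, assumption+, intro allI impI, elim conjE, rule closed)
qed

lemma map2_act_Stay: "map2 act (map (\<lambda>t. (scanned t, Stay)) ts) ts = ts"
  by (induction ts) auto

lemma step_comb_prog:
  assumes "Suc (length ts) = tapes M"
    and "prog_step h (a, t, x, y) = Some ((a', t', x', y'), out)"
  shows "step (comb M h) (prod_encode (a, q), t # ts @ [x, y]) =
           Some ((prod_encode (a', q), t' # ts @ [x', y']), out)"
proof -
  have [simp]: "tapes M = Suc (length ts)" using assms(1) by simp
  have "a \<noteq> 0" using assms(2) by (auto split: if_splits)
  moreover obtain u v w where "prog h a (scanned t) (scanned x) (scanned y) = (a', u, v, w, out)"
    "t' = act u t" "x' = act v x" "y' = act w y"
    using assms(2) by (auto split: if_splits prod.splits)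
  ultimately show ?thesis
    by (simp add: step_def comb_def comb_delta_def nth_append o_def map2_act_Stay)
qed

text \<open>A control step acts on three tapes only and lengthens each by at most one cell, hence
  the factor 3.\<close>

lemma halting_run_comb_prog:
  assumes "run (prog_step h) (a, t, x, y) os (a', t', x', y')"
    and "Suc (length ts) = tapes M"
    and "halting_run (comb M h) (prod_encode (a', q), t' # ts @ [x', y']) os' ss'"
  shows "\<exists>ss. halting_run (comb M h) (prod_encode (a, q), t # ts @ [x, y]) (os @ os') (ss @ ss') \<and>
     (\<forall>s \<in> set ss. s \<le> space (prod_encode (a, q), t # ts @ [x, y]) + 3 * length os)"
  using assms(1,3)
proof (induction "(a, t, x, y)" os "(a', t', x', y')" arbitrary: a t x y rule: run.induct)
  case run_refl
  then show ?case by (intro exI[of _ "[]"]) simp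
next
  case (run_step c1 out os)
  obtain a1 t1 x1 y1 where c1: "c1 = (a1, t1, x1, y1)" by (cases c1)
  then obtain ss where ss:
    "halting_run (comb M h) (prod_encode (a1, q), t1 # ts @ [x1, y1]) (os @ os') (ss @ ss')"
    "\<forall>s \<in> set ss. s \<le> space (prod_encode (a1, q), t1 # ts @ [x1, y1]) + 3 * length os"
    using run_step by blast
  have "tape_cells t1 \<le> Suc (tape_cells t)" "tape_cells x1 \<le> Suc (tape_cells x)"
    "tape_cells y1 \<le> Suc (tape_cells y)"
    using run_step(1) c1 by (auto split: if_splits prod.splits simp: tape_cells_act)
  then have le: "space (prod_encode (a1, q), t1 # ts @ [x1, y1]) \<le>
      space (prod_encode (a, q), t # ts @ [x, y]) + 3"
    by (auto simp: space_def)
  let ?s = "space (prod_encode (a, q), t # ts @ [x, y])"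
  have "halting_run (comb M h) (prod_encode (a, q), t # ts @ [x, y]) ((out # os) @ os')
      ((?s # ss) @ ss')"
    using halting_run.step[OF step_comb_prog[OF assms(2)] ss(1)] run_step(1) c1 by simp
  moreover have "\<forall>s \<in> set (?s # ss). s \<le> ?s + 3 * length (out # os)"
    using ss(2) le by fastforce
  ultimately show ?case by blast
qed

section \<open>Step-by-step simulation of the original machine\<close>

lemma map2_act_padded:
  "list_all2 padded ts ts' \<Longrightarrow> list_all2 padded (map2 act acts ts) (map2 act acts ts')"
  by (auto simp: list_all2_conv_all_nth padded_act)

text \<open>\<open>wf_tm\<close> constrains \<open>delta\<close> only on states and symbols of the
  machine, so membership must be carried along the run. It guarantees one action per tape, without
  which the two appended actions would reach the wrong tapes.\<close>

definition valid_config :: "tm \<Rightarrow> config \<Rightarrow> bool" where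
  "valid_config M c \<longleftrightarrow> fst c \<in> states M \<and> length (snd c) = tapes M \<and>
     (\<forall>t \<in> set (snd c). tape_symbols t \<subseteq> alphabet M)"

lemma valid_config_delta:
  assumes "wf_tm M" "valid_config M c" "delta M (fst c) (map scanned (snd c)) = Some (q', acts, out)"
  shows "length acts = tapes M" "valid_config M (q', map2 act acts (snd c))"
proof -
  have "set (map scanned (snd c)) \<subseteq> alphabet M"
    using assms(2) by (auto simp: valid_config_def intro: subsetD[OF _ scanned_in_tape_symbols])
  then have *: "q' \<in> states M \<and> length acts = tapes M \<and> fst ` set acts \<subseteq> alphabet M"
    using wf_tm_delta[OF assms(1) _ _ _ assms(3)] assms(2) by (simp add: valid_config_def)
  then show "length acts = tapes M" by simp
  have "tape_symbols t \<subseteq> alphabet M" if t: "t \<in> set (map2 act acts (snd c))" for t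
  proof -
    obtain u t0 where ut: "(u, t0) \<in> set (zip acts (snd c))" "t = act u t0"
      using t by force
    have "u \<in> set acts" "t0 \<in> set (snd c)"
      using set_zip_leftD[OF ut(1)] set_zip_rightD[OF ut(1)] .
    moreover have "Blank \<in> alphabet M" using assms(1) by (auto simp: wf_tm_def)
    ultimately show ?thesis
      using ut(2) tape_symbols_act[of u t0] * assms(2) by (auto simp: valid_config_def image_subset_iff)
  qed
  then show "valid_config M (q', map2 act acts (snd c))"
    using * assms(2) by (auto simp: valid_config_def)
qed

text \<open>Here \<open>n\<close> and \<open>n'\<close> count the steps since the last solution in
  the original and the combined run; the lag \<open>K'\<close> makes room for the preparation. At a
  \<open>Done\<close> the delay is at most \<open>n' + K + 2\<close> with
  \<open>n + 1 \<le> D\<close>. The space adds one padding cell per tape,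
  \<open>length e + 2\<close> for the copy, \<open>D + 2\<close> for the buffer and
  \<open>3 * (K + 1)\<close> for the control steps.\<close>

lemma halting_run_comb:
  assumes M: "wf_tm M"
    and "halting_run M c os ss" "valid_config M c" "list_all2 padded (snd c) ts"
    and "list_all2 (translates h e K) (solutions w os) vs"
    and "\<forall>d \<in> set (delays n os). d \<le> D" "\<forall>s \<in> set ss. s \<le> P"
    and "length w \<le> n" "length w + z \<le> D" "n' \<le> n + K'"
  shows "\<exists>os' ss'.
    halting_run (comb M h) (prod_encode (0, fst c), ts @ [tape_home e 0, tape_at w [] z]) os' ss' \<and>
    solutions [] os' = vs \<and> (\<forall>d \<in> set (delays n' os'). d \<le> D + K' + K + 1) \<and>
    (\<forall>s \<in> set ss'. s \<le> P + tapes M + length e + D + 3 * K + 7)"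
  using assms(2-)
proof (induction arbitrary: ts w z n n' vs rule: halting_run.induct)
  case (halt c)
  let ?c = "(prod_encode (0, fst c), ts @ [tape_home e 0, tape_at w [] z])"
  have sc: "map scanned ts = map scanned (snd c)"
    using halt(3) by (auto simp: list_all2_conv_all_nth padded_scanned intro!: nth_equalityI)
  have len: "length ts = tapes M" "length (snd c) = tapes M"
    using halt(2,3) by (auto simp: valid_config_def dest: list_all2_lengthD)
  have "step (comb M h) ?c = None"
    using halt(1) sc len by (auto simp: step_def comb_def comb_delta_def split: option.splits)
  then have "halting_run (comb M h) ?c [] [space ?c]" by (rule halting_run.halt)
  moreover have "space ?c \<le> P + tapes M + length e + D + 3 * K + 7"
    using list_all2_padded_cells[OF halt(3)] halt(6,8) len by (auto simp: space_def)
  moreover have "n \<le> D" using halt(5) by simp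
  ultimately show ?case using halt by (intro exI[of _ "[]"] exI[of _ "[space ?c]"]) auto
next
  case (step c c1 out os ss)
  let ?x = "tape_home e 0" and ?B = "P + tapes M + length e + D + 3 * K + 7"
  let ?y = "tape_at w [] z"
  let ?c = "(prod_encode (0, fst c), ts @ [?x, ?y])"
  have sc: "map scanned ts = map scanned (snd c)"
    using step(5) by (auto simp: list_all2_conv_all_nth padded_scanned intro!: nth_equalityI)
  have len: "length ts = tapes M" "length (snd c) = tapes M"
    using step(4,5) by (auto simp: valid_config_def dest: list_all2_lengthD)
  obtain q' acts where d: "delta M (fst c) (map scanned (snd c)) = Some (q', acts, out)"
    and c1: "c1 = (q', map2 act acts (snd c))"
    using step(1) by (auto simp: step_def split: option.splits)
  note v = valid_config_delta[OF M step(4) d]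
  let ?ts = "map2 act acts ts"
  have pad: "list_all2 padded (snd c1) ?ts"
    using map2_act_padded[OF step(5)] c1 by simp
  have stepc: "Defs.step (comb M h) ?c = Some ((prod_encode (if out = Done then 4 else 0, q'),
      ?ts @ [?x, act (case out of Put s \<Rightarrow> (s, MoveR) | _ \<Rightarrow> (Blank, Stay)) ?y]), Silent)"
    using d sc len v(1) by (auto simp: step_def comb_def comb_delta_def nth_append split: emission.splits)
  have sp: "space ?c \<le> ?B"
    using list_all2_padded_cells[OF step(5)] step(8,10) len by (auto simp: space_def)
  show ?case
  proof (cases out)
    case Silent
    have "\<exists>os' ss'.
      halting_run (comb M h) (prod_encode (0, fst c1), ?ts @ [?x, ?y]) os' ss' \<and>
      solutions [] os' = vs \<and> (\<forall>d \<in> set (delays (Suc n') os'). d \<le> D + K' + K + 1) \<and>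
      (\<forall>s \<in> set ss'. s \<le> ?B)"
      using step v c1 Silent by (intro step.IH[OF _ pad, of w vs "Suc n"]) auto
    then obtain os' ss' where *: "halting_run (comb M h) (prod_encode (0, fst c1), ?ts @ [?x, ?y]) os' ss'"
      "solutions [] os' = vs" "\<forall>d \<in> set (delays (Suc n') os'). d \<le> D + K' + K + 1"
      "\<forall>s \<in> set ss'. s \<le> ?B" by blast
    have "halting_run (comb M h) ?c (Silent # os') (space ?c # ss')"
      using stepc *(1) Silent c1 by (intro halting_run.step) auto
    then show ?thesis using * sp
      by (intro exI[of _ "Silent # os'"] exI[of _ "space ?c # ss'"]) auto
  next
    case (Put s)
    let ?y1 = "tape_at (w @ [s]) [] (z - 1)"
    \<comment> \<open>Needed for \<open>z = 0\<close>, where \<open>z - 1\<close> is 0 and the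
      buffer really grows: its new length is at most \<open>Suc n\<close>.\<close>
    have nD: "Suc n \<le> D" using step(7) Put delays_bound[of "Suc n" os D] by auto
    have "\<exists>os' ss'.
      halting_run (comb M h) (prod_encode (0, fst c1), ?ts @ [?x, ?y1]) os' ss' \<and>
      solutions [] os' = vs \<and> (\<forall>d \<in> set (delays (Suc n') os'). d \<le> D + K' + K + 1) \<and>
      (\<forall>s \<in> set ss'. s \<le> ?B)"
      using step v c1 Put nD by (intro step.IH[OF _ pad, of "w @ [s]" vs "Suc n"]) auto
    then obtain os' ss' where *: "halting_run (comb M h) (prod_encode (0, fst c1), ?ts @ [?x, ?y1]) os' ss'"
      "solutions [] os' = vs" "\<forall>d \<in> set (delays (Suc n') os'). d \<le> D + K' + K + 1"
      "\<forall>s \<in> set ss'. s \<le> ?B" by blast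
    have "act (s, MoveR) ?y = ?y1" by (cases z) auto
    then have "halting_run (comb M h) ?c (Silent # os') (space ?c # ss')"
      using stepc *(1) Put c1 by (intro halting_run.step) auto
    then show ?thesis using * sp
      by (intro exI[of _ "Silent # os'"] exI[of _ "space ?c # ss'"]) auto
  next
    case Done
    let ?y1 = "tape_at [] [] (z + length w)"
    obtain v' vs' where vs: "vs = v' # vs'" "translates h e K w v'"
      "list_all2 (translates h e K) (solutions [] os) vs'"
      using step(6) Done by (auto simp: list_all2_Cons1)
    have "\<exists>os' ss'.
      halting_run (comb M h) (prod_encode (0, fst c1), ?ts @ [?x, ?y1]) os' ss' \<and>
      solutions [] os' = vs' \<and> (\<forall>d \<in> set (delays 0 os'). d \<le> D + K' + K + 1) \<and>
      (\<forall>s \<in> set ss'. s \<le> ?B)"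
      using step v c1 Done vs by (intro step.IH[OF _ pad, of "[]" vs' 0]) auto
    then obtain os' ss' where *: "halting_run (comb M h) (prod_encode (0, fst c1), ?ts @ [?x, ?y1]) os' ss'"
      "solutions [] os' = vs'" "\<forall>d \<in> set (delays 0 os'). d \<le> D + K' + K + 1"
      "\<forall>s \<in> set ss'. s \<le> ?B" by blast
    have "0 < tapes M" using M by (simp add: wf_tm_def)
    moreover have "length ?ts = tapes M" using v(1) len by simp
    ultimately obtain t ts1 where ts: "?ts = t # ts1" "Suc (length ts1) = tapes M"
      by (metis Suc_length_conv gr0_conv_Suc)
    obtain es where es: "run (prog_step h) (4, t, ?x, ?y) (es @ [Done]) (0, t, ?x, ?y1)"
      "Done \<notin> set es" "puts es = v'" "length es \<le> K"
      using vs(2) unfolding translates_def by blast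
    obtain ss1 where ss1: "halting_run (comb M h) (prod_encode (4, q'), t # ts1 @ [?x, ?y])
        ((es @ [Done]) @ os') (ss1 @ ss')"
      "\<forall>s \<in> set ss1. s \<le> space (prod_encode (4, q'), t # ts1 @ [?x, ?y]) + 3 * length (es @ [Done])"
      using halting_run_comb_prog[OF es(1) ts(2), of q' os' ss'] *(1) ts c1 by auto
    have "halting_run (comb M h) ?c (Silent # (es @ [Done]) @ os') (space ?c # ss1 @ ss')"
      using stepc ss1(1) Done ts by (intro halting_run.step) auto
    moreover have "solutions [] (Silent # (es @ [Done]) @ os') = vs"
      using es *(2) vs(1) by (simp add: solutions_append)
    moreover have "n + 1 \<le> D" using step(7) Done by simp
    then have "\<forall>d \<in> set (delays n' (Silent # (es @ [Done]) @ os')). d \<le> D + K' + K + 1"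
      using es *(3) step(11) by (simp add: delays_append)
    \<comment> \<open>The space list of the remaining run begins with the space of
      \<open>c1\<close>, on whose tapes the translation starts.\<close>
    moreover have "sum_list (map tape_cells (snd c1)) \<le> P"
      using step(2,8) by (cases rule: halting_run.cases) (auto simp: space_def)
    then have "space (prod_encode (4, q'), t # ts1 @ [?x, ?y]) \<le> P + tapes M + length e + D + 4"
      using list_all2_padded_cells[OF pad] step(10) len v(1) c1 unfolding space_def ts by simp
    then have "space (prod_encode (4, q'), t # ts1 @ [?x, ?y]) + 3 * length (es @ [Done]) \<le> ?B"
      using es(4) by simp
    then have "\<forall>s \<in> set ss1. s \<le> ?B"
      using ss1(2) order_trans by blast
    then have "\<forall>s \<in> set (space ?c # ss1 @ ss'). s \<le> ?B"
      using *(4) sp by (simp only: set_simps set_append ball_simps ball_Un simp_thms)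
    ultimately show ?thesis by blast
  qed
qed

text \<open>The reduction principle used in both directions: injectivity of \<open>f x\<close>
  preserves the absence of repetitions, surjectivity the completeness of the list.\<close>

lemma enumerable_translate:
  fixes r :: "nat poly"
  assumes enum: "poly_delay_poly_space_enumerable I enc S enc_sol"
    and h: "wf_translator h"
    and enc: "\<And>x. x \<in> I \<Longrightarrow> set (enc x) \<subseteq> range Bit \<union> {EqSym, NeqSym, Sep}"
    and bij: "\<And>x. x \<in> I \<Longrightarrow> bij_betw (f x) (S x) (S' x)"
    and trans: "\<And>x s. x \<in> I \<Longrightarrow> s \<in> S x \<Longrightarrow>
      translates h (enc x) (poly r (length (enc x))) (enc_sol x s) (enc_sol' x (f x s))"
  shows "poly_delay_poly_space_enumerable I enc S' enc_sol'"
proof -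
  obtain M p where M: "wf_tm M" and run: "\<And>x. x \<in> I \<Longrightarrow> \<exists>os ss sols.
       halting_run M (init_config M (enc x)) os ss \<and>
       distinct sols \<and> set sols = S x \<and> solutions [] os = map (enc_sol x) sols \<and>
       (\<forall>d \<in> set (delays 0 os). d \<le> poly p (length (enc x))) \<and>
       (\<forall>s \<in> set ss. s \<le> poly p (length (enc x)))"
    using enum unfolding poly_delay_poly_space_enumerable_def by blast
  \<comment> \<open>Two copies of \<open>p\<close> and three of \<open>r\<close> dominate the space
    bound of the simulation; the coefficient 6 comes from the preparation, three heads for about
    twice the input length, and 20 generously covers the constants.\<close>
  define p' where "p' = p + p + r + r + r + [:tapes M + 20, 6:]"
  have "\<exists>os ss sols.
       halting_run (comb M h) (init_config (comb M h) (enc x)) os ss \<and>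
       distinct sols \<and> set sols = S' x \<and> solutions [] os = map (enc_sol' x) sols \<and>
       (\<forall>d \<in> set (delays 0 os). d \<le> poly p' (length (enc x))) \<and>
       (\<forall>s \<in> set ss. s \<le> poly p' (length (enc x)))" if x: "x \<in> I" for x
  proof -
    let ?e = "enc x" and ?D = "poly p (length (enc x))" and ?K = "poly r (length (enc x))"
    let ?K' = "2 * length ?e + 3"
    obtain os ss sols where os: "halting_run M (init_config M ?e) os ss"
       "distinct sols" "set sols = S x" "solutions [] os = map (enc_sol x) sols"
       "\<forall>d \<in> set (delays 0 os). d \<le> ?D" "\<forall>s \<in> set ss. s \<le> ?D"
      using run[OF x] by blast
    let ?rest = "replicate (tapes M - 1) (tape_of [])"
    have tp: "0 < tapes M" and al: "{Blank, EqSym, NeqSym, Sep} \<union> range Bit \<subseteq> alphabet M"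
      and st: "start M \<in> states M"
      using M by (simp_all add: wf_tm_def)
    have nb: "Blank \<notin> set ?e" using enc[OF x] by auto
    have "tape_symbols (tape_of ?e) \<subseteq> alphabet M"
      using enc[OF x] al by (cases ?e) auto
    then have valid: "valid_config M (init_config M ?e)"
      using tp al st by (auto simp: valid_config_def init_config_def)
    have pad: "list_all2 padded (snd (init_config M ?e)) (input_padded_at [] ?e # ?rest)"
      by (auto simp: init_config_def padded_input padded_refl list_all2_conv_all_nth nth_Cons split: nat.splits)
    have tr: "list_all2 (translates h ?e ?K) (solutions [] os) (map (\<lambda>s. enc_sol' x (f x s)) sols)"
      using trans[OF x] os(3,4) by (auto simp: list_all2_map1 list_all2_map2 list_all2_same)
    \<comment> \<open>The preparation is charged to the first delay: the combined counter starts at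
      \<open>?K'\<close> while the original one starts at 0.\<close>
    obtain os' ss' where os': "halting_run (comb M h)
        (prod_encode (0, start M), input_padded_at [] ?e # ?rest @ [tape_home ?e 0, tape_at [] [] 0]) os' ss'"
      "solutions [] os' = map (\<lambda>s. enc_sol' x (f x s)) sols"
      "\<forall>d \<in> set (delays ?K' os'). d \<le> ?D + ?K' + ?K + 1"
      "\<forall>s \<in> set ss'. s \<le> ?D + tapes M + length ?e + ?D + 3 * ?K + 7"
      using halting_run_comb[OF M os(1) valid pad tr os(5,6), of 0 ?K' ?K'] by (auto simp: init_config_def)
    let ?c = "(prod_encode (1, start M), tape_of ?e # ?rest @ [tape_of [], tape_of []])"
    have "Suc (length ?rest) = tapes M" using tp by simp
    then obtain ss1 where ss1: "halting_run (comb M h) ?c (replicate ?K' Silent @ os') (ss1 @ ss')"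
      "\<forall>s \<in> set ss1. s \<le> space ?c + 3 * length (replicate ?K' Silent)"
      using halting_run_comb_prog[OF run_preparation[OF nb] _ os'(1)] by blast
    have ic: "init_config (comb M h) ?e = ?c"
    proof -
      have "tapes M + 1 = (tapes M - 1) + 2" using tp by simp
      then have "replicate (tapes M + 1) (tape_of []) = ?rest @ replicate 2 (tape_of [])"
        by (metis replicate_add)
      then show ?thesis by (simp add: init_config_def comb_def numeral_2_eq_2)
    qed
    have "space (init_config M ?e) \<le> ?D"
      using os(1,6) by (cases rule: halting_run.cases) auto
    then have "space ?c \<le> ?D + 2" by (simp add: space_def init_config_def)
    then have "space ?c + 3 * length (replicate ?K' Silent) \<le> poly p' (length ?e)"
      by (simp add: p'_def)
    then have "\<forall>s \<in> set ss1. s \<le> poly p' (length ?e)"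
      using ss1(2) order_trans by blast
    moreover have "?D + tapes M + length ?e + ?D + 3 * ?K + 7 \<le> poly p' (length ?e)"
      by (simp add: p'_def)
    then have "\<forall>s \<in> set ss'. s \<le> poly p' (length ?e)"
      using os'(4) order_trans by blast
    ultimately have "\<forall>s \<in> set (ss1 @ ss'). s \<le> poly p' (length ?e)"
      by (simp only: set_append ball_Un simp_thms)
    moreover have "\<forall>d \<in> set (delays 0 (replicate ?K' Silent @ os')). d \<le> poly p' (length ?e)"
    proof -
      have "delays 0 (replicate ?K' Silent @ os') = delays ?K' os'"
        by (subst delays_append) auto
      moreover have "?D + ?K' + ?K + 1 \<le> poly p' (length ?e)"
        by (simp add: p'_def)
      then have "\<forall>d \<in> set (delays ?K' os'). d \<le> poly p' (length ?e)"
        using os'(3) order_trans by blast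
      ultimately show ?thesis by (simp only:)
    qed
    moreover have "solutions [] (replicate ?K' Silent @ os') = map (enc_sol' x) (map (f x) sols)"
      using os'(2) by (subst solutions_append) auto
    moreover have "distinct (map (f x) sols)" "set (map (f x) sols) = S' x"
      using bij[OF x] os(2,3) by (auto simp: bij_betw_def distinct_map)
    ultimately show ?thesis using ss1(1) unfolding ic by (intro exI conjI)
  qed
  then show ?thesis
    using wf_comb[OF M h] unfolding poly_delay_poly_space_enumerable_def by blast
qed


section \<open>Translating between bit vectors and selected blocks\<close>

definition blocks :: "symbol list list \<Rightarrow> symbol list" where
  "blocks us = concat (map (\<lambda>u. u @ [Sep]) us)"

text \<open>The common shape of both encodings: with the clause words as \<open>us\<close> and the
  signature as \<open>bs\<close>, the corresponding subgraph is written as the blocks of the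
  selected words.\<close>

definition selected :: "bool list \<Rightarrow> 'a list \<Rightarrow> 'a list" where
  "selected bs us = map snd (filter fst (zip bs us))"

lemma blocks_simps [simp]: "blocks [] = []" "blocks (u # us) = u @ Sep # blocks us"
  by (auto simp: blocks_def)

lemma selected_simps [simp]:
  "selected [] us = []"
  "selected (b # bs) (u # us) = (if b then u # selected bs us else selected bs us)"
  by (auto simp: selected_def)

lemma set_selected_subset: "set (selected bs us) \<subseteq> set us"
  by (auto simp: selected_def dest: set_zip_rightD)

lemma length_blocks_selected: "length (blocks (selected bs us)) \<le> length (blocks us)"
proof (induction us arbitrary: bs)
  case Nil
  then show ?case by (simp add: selected_def)
next
  case (Cons u us)
  then show ?case by (cases bs) (auto intro: le_SucI trans_le_add2)
qed

lemma length_le_blocks: "length us \<le> length (blocks us)"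
  by (induction us) auto

text \<open>The buffer head rests on one bit during a whole block of the copy, so the block can be
  echoed symbol by symbol as it is read.\<close>

definition select_blocks :: translator where
  "select_blocks a x y =
    (if a \<noteq> 6 \<or> x = Blank then (7, MoveL, MoveL, Silent)
     else (6, MoveR, if x = Sep then MoveR else Stay, if y = Bit True then Put x else Silent))"

lemma prog_select_blocks:
  "prog select_blocks 6 s x y =
    (if x = Blank then (7, (s, Stay), (x, MoveL), (y, MoveL), Silent)
     else (6, (s, Stay), (x, MoveR), (y, if x = Sep then MoveR else Stay),
       if y = Bit True then Put x else Silent))"
  by (simp add: prog_def select_blocks_def)

lemma wf_select_blocks: "wf_translator select_blocks"
  by (auto simp: wf_translator_def select_blocks_def)

lemma run_select_block:
  assumes "Blank \<notin> set u" "Sep \<notin> set u"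
  shows "run (prog_step select_blocks) (6, t, tape_at p (u @ Sep # q) 0, tape_at r (Bit b # v) z)
    (map (\<lambda>s. if b then Put s else Silent) (u @ [Sep]))
    (6, t, tape_at (p @ u @ [Sep]) q 0, tape_at (r @ [Bit b]) v z)"
  using assms
proof (induction u arbitrary: p)
  case Nil
  then show ?case by (auto intro!: run_single simp: prog_select_blocks)
next
  case (Cons a u)
  have 1: "run (prog_step select_blocks) (6, t, tape_at (p @ [a]) (u @ Sep # q) 0, tape_at r (Bit b # v) z)
    (map (\<lambda>s. if b then Put s else Silent) (u @ [Sep]))
    (6, t, tape_at (p @ (a # u) @ [Sep]) q 0, tape_at (r @ [Bit b]) v z)"
    using Cons.IH[of "p @ [a]"] Cons.prems by simp
  have 2: "prog_step select_blocks (6, t, tape_at p (a # u @ Sep # q) 0, tape_at r (Bit b # v) z) =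
    Some ((6, t, tape_at (p @ [a]) (u @ Sep # q) 0, tape_at r (Bit b # v) z), if b then Put a else Silent)"
    using Cons.prems by (auto simp: prog_select_blocks)
  show ?case using run_step[where f = "prog_step select_blocks", OF 2 1]
    by (simp only: list.map append_Cons)
qed

lemma puts_map_Put: "puts (map (\<lambda>s. if b then Put s else Silent) u) = (if b then u else [])"
  by (induction u) auto

lemma run_select_blocks:
  assumes "\<forall>u \<in> set us. Blank \<notin> set u \<and> Sep \<notin> set u" "length bs = length us"
  shows "\<exists>os. run (prog_step select_blocks) (6, t, tape_at p (blocks us) 0, tape_at r (map Bit bs) z) os
      (7, t, move_head MoveL (tape_at (p @ blocks us) [] 0),
        move_head MoveL (tape_at (r @ map Bit bs) [] z)) \<and>
    Done \<notin> set os \<and> puts os = blocks (selected bs us) \<and> length os \<le> length (blocks us) + 1"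
  using assms(2,1)
proof (induction bs us arbitrary: p r rule: list_induct2)
  case Nil
  then show ?case
    by (intro exI[of _ "[Silent]"]) (auto intro!: run_single simp: prog_select_blocks)
next
  case (Cons b bs u us)
  let ?os = "map (\<lambda>s. if b then Put s else Silent) (u @ [Sep])"
  have 1: "run (prog_step select_blocks)
      (6, t, tape_at p (blocks (u # us)) 0, tape_at r (map Bit (b # bs)) z) ?os
      (6, t, tape_at (p @ u @ [Sep]) (blocks us) 0, tape_at (r @ [Bit b]) (map Bit bs) z)"
    using run_select_block Cons.prems by simp
  obtain os where os: "run (prog_step select_blocks)
      (6, t, tape_at (p @ u @ [Sep]) (blocks us) 0, tape_at (r @ [Bit b]) (map Bit bs) z) os
      (7, t, move_head MoveL (tape_at ((p @ u @ [Sep]) @ blocks us) [] 0),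
        move_head MoveL (tape_at ((r @ [Bit b]) @ map Bit bs) [] z))"
    "Done \<notin> set os" "puts os = blocks (selected bs us)" "length os \<le> length (blocks us) + 1"
    using Cons.IH[of "p @ u @ [Sep]" "r @ [Bit b]"] Cons.prems by auto
  show ?case
    using run_trans[OF 1 os(1)] os(2-) puts_map_Put[of b "u @ [Sep]"]
    by (intro exI[of _ "?os @ os"]) auto
qed

lemma translates_select_blocks:
  assumes "\<forall>u \<in> set us. Blank \<notin> set u \<and> Sep \<notin> set u" "length bs = length us"
    and "4 * length (blocks us) + 4 \<le> K"
  shows "translates select_blocks (blocks us) K (map Bit bs) (blocks (selected bs us))"
proof -
  have "core_translates select_blocks (blocks us) (map Bit bs) (blocks (selected bs us))
      (length (blocks us) + 1)"
    using run_select_blocks[OF assms(1,2), of _ "[]" "[]"] by (simp add: core_translates_def)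
  moreover have "Blank \<notin> set (blocks us)" "Blank \<notin> set (map Bit bs)"
    using assms(1) by (auto simp: blocks_def)
  ultimately have "translates select_blocks (blocks us)
      (length (blocks us) + 1 + 2 * length (map Bit bs) + length (blocks us) + 3) (map Bit bs)
      (blocks (selected bs us))"
    by (rule core_translates_imp_translates)
  \<comment> \<open>There is one bit per block and every block has a separator, so the number of
    bits is at most the length of the copy.\<close>
  moreover have "length (blocks us) + 1 + 2 * length (map Bit bs) + length (blocks us) + 3 \<le> K"
    using assms(2,3) length_le_blocks[of us] by simp
  ultimately show ?thesis unfolding translates_def by (meson order_trans)
qed

text \<open>State 6 compares the current blocks of the two tapes; after a mismatch, state 9 skips the
  rest of the block of the copy and state 10 moves back to the beginning of the buffered block.\<close>

definition mark_blocks :: translator where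
  "mark_blocks a x y =
    (if a = 9 then
       (if x = Sep then (10, MoveR, MoveL, Put (Bit False)) else (9, MoveR, Stay, Silent))
     else if a = 10 then
       (if y = Sep \<or> y = Blank then (6, Stay, MoveR, Silent) else (10, Stay, MoveL, Silent))
     else if x = Blank then (7, MoveL, MoveL, Silent)
     else if x = y then (6, MoveR, MoveR, if x = Sep then Put (Bit True) else Silent)
     else (9, Stay, Stay, Silent))"

lemma prog_mark_blocks:
  "prog mark_blocks 6 s x y =
    (if x = Blank then (7, (s, Stay), (x, MoveL), (y, MoveL), Silent)
     else if x = y then
       (6, (s, Stay), (x, MoveR), (y, MoveR), if x = Sep then Put (Bit True) else Silent)
     else (9, (s, Stay), (x, Stay), (y, Stay), Silent))"
  "prog mark_blocks 9 s x y =
    (if x = Sep then (10, (s, Stay), (x, MoveR), (y, MoveL), Put (Bit False))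
     else (9, (s, Stay), (x, MoveR), (y, Stay), Silent))"
  "prog mark_blocks 10 s x y =
    (if y = Sep \<or> y = Blank then (6, (s, Stay), (x, Stay), (y, MoveR), Silent)
     else (10, (s, Stay), (x, Stay), (y, MoveL), Silent))"
  by (auto simp: prog_def mark_blocks_def)

lemma wf_mark_blocks: "wf_translator mark_blocks"
  by (auto simp: wf_translator_def mark_blocks_def)

lemma run_mark_compare:
  assumes "Blank \<notin> set u" "Sep \<notin> set u"
  shows "run (prog_step mark_blocks) (6, t, tape_at p (u @ q) 0, tape_at r (u @ v) z)
    (replicate (length u) Silent) (6, t, tape_at (p @ u) q 0, tape_at (r @ u) v z)"
  using assms
proof (induction u arbitrary: p r)
  case Nil
  then show ?case by (simp add: run_refl)
next
  case (Cons a u)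
  then show ?case
    by (auto intro!: run_step[OF _ Cons.IH[of "p @ [a]" "r @ [a]", simplified]]
      simp: prog_mark_blocks)
qed

lemma run_mark_skip:
  assumes "Sep \<notin> set u"
  shows "run (prog_step mark_blocks) (9, t, tape_at p (u @ Sep # q) 0, y)
    (replicate (length u) Silent @ [Put (Bit False)])
    (10, t, tape_at (p @ u @ [Sep]) q 0, move_head MoveL y)"
  using assms
proof (induction u arbitrary: p)
  case Nil
  then show ?case by (auto intro!: run_single simp: prog_mark_blocks act_scanned)
next
  case (Cons a u)
  then show ?case
    by (auto intro!: run_step[OF _ Cons.IH[of "p @ [a]", simplified]]
      simp: prog_mark_blocks act_scanned)
qed

text \<open>The start of the buffered block is recognised by the cell before it: the left blank if
  \<open>r\<close> is empty, else the separator ending the preceding block. Since \<open>u\<close>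
  contains neither symbol, the scan cannot stop early.\<close>

lemma run_mark_back:
  assumes "Blank \<notin> set u" "Sep \<notin> set u" "r = [] \<or> last r = Sep"
  shows "run (prog_step mark_blocks) (10, t, x, move_head MoveL (tape_at (r @ u) v z))
    (replicate (Suc (length u)) Silent) (6, t, x, tape_at r (u @ v) z)"
  using assms(1,2)
proof (induction u arbitrary: v rule: rev_induct)
  case Nil
  show ?case
  proof (cases r rule: rev_cases)
    case Nil
    then show ?thesis by (auto intro!: run_single simp: prog_mark_blocks act_scanned)
  next
    case (snoc r' a)
    then show ?thesis using assms(3)
      by (auto intro!: run_single simp: prog_mark_blocks act_scanned)
  qed
next
  case (snoc a u)
  have "run (prog_step mark_blocks) (10, t, x, move_head MoveL (tape_at (r @ u) (a # v) z))
    (replicate (Suc (length u)) Silent) (6, t, x, tape_at r (u @ a # v) z)"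
    using snoc by simp
  moreover have "prog_step mark_blocks (10, t, x, move_head MoveL (tape_at (r @ u @ [a]) v z)) =
    Some ((10, t, x, move_head MoveL (tape_at (r @ u) (a # v) z)), Silent)"
    using snoc.prems move_tape_at(2)[of "r @ u" a v z] by (auto simp: prog_mark_blocks)
  ultimately show ?case by (auto intro: run_step)
qed

text \<open>The appended \<open>Sep\<close> settles the case that one word is a proper prefix of the
  other: it then differs from the next letter of the longer word.\<close>

lemma first_mismatch:
  assumes "u \<noteq> v" "Sep \<notin> set u" "Sep \<notin> set v"
  obtains p a b u' v' where "u @ [Sep] = p @ a # u'" "v @ [Sep] = p @ b # v'" "a \<noteq> b"
    "Sep \<notin> set p" "set p \<subseteq> set u"
  using assms
proof (induction u arbitrary: v thesis)
  case Nil
  then show ?case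
    by (cases v) (auto intro: Nil.prems(1)[of "[]"])
next
  case (Cons a u)
  show ?case
  proof (cases "v \<noteq> [] \<and> hd v = a")
    case True
    then obtain v1 where v: "v = a # v1" by (cases v) auto
    obtain p a' b u' v' where "u @ [Sep] = p @ a' # u'" "v1 @ [Sep] = p @ b # v'" "a' \<noteq> b"
      "Sep \<notin> set p" "set p \<subseteq> set u"
      using Cons.prems v by (auto intro: Cons.IH[of v1])
    then show ?thesis using Cons.prems(1)[of "a # p" a' u' b v'] Cons.prems v by auto
  next
    case False
    then show ?thesis using Cons.prems
      by (cases v) (auto intro: Cons.prems(1)[of "[]"])
  qed
qed

text \<open>Only the first remaining block of the buffer is compared. The common part
  \<open>c\<close> is traversed forward and back on the buffer, while the copy moves on past its own
  block.\<close>

lemma run_mark_mismatch: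
  assumes "Blank \<notin> set u" "Sep \<notin> set u" "r = [] \<or> last r = Sep"
    and us: "\<forall>u' \<in> set us. Sep \<notin> set u'" "u \<notin> set us"
  shows "\<exists>os. run (prog_step mark_blocks)
      (6, t, tape_at p (u @ Sep # q) 0, tape_at r (blocks us) z) os
      (6, t, tape_at (p @ u @ [Sep]) q 0, tape_at r (blocks us) z) \<and>
    Done \<notin> set os \<and> puts os = [Bit False] \<and> length os \<le> 6 * length u + 6"
proof -
  have "\<exists>c a u' v'. u @ [Sep] = c @ a # u' \<and> blocks us = c @ v' \<and> a \<noteq> hd (v' @ [Blank]) \<and>
      Sep \<notin> set c \<and> set c \<subseteq> set u"
  proof (cases us)
    case Nil
    \<comment> \<open>An exhausted buffer shows the blank behind its word, which already differs
      from the first symbol of the block of the copy.\<close>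
    have "hd (u @ [Sep]) \<noteq> Blank" using assms(1) by (cases u) auto
    then have "u @ [Sep] = [] @ hd (u @ [Sep]) # tl (u @ [Sep]) \<and> blocks us = [] @ [] \<and>
      hd (u @ [Sep]) \<noteq> hd ([] @ [Blank]) \<and> Sep \<notin> set [] \<and> set [] \<subseteq> set u"
      using Nil by simp
    then show ?thesis by blast
  next
    case (Cons v vs)
    have "u \<noteq> v" "Sep \<notin> set v" using us Cons by auto
    then obtain c a b u' v' where c: "u @ [Sep] = c @ a # u'" "v @ [Sep] = c @ b # v'" "a \<noteq> b"
      "Sep \<notin> set c" "set c \<subseteq> set u"
      using first_mismatch assms(2) by metis
    have "blocks us = (v @ [Sep]) @ blocks vs" using Cons by simp
    then have "blocks us = c @ b # v' @ blocks vs" using c(2) by simp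
    then show ?thesis using c by (metis append_Cons list.sel(1))
  qed
  then obtain c a u' v' where c: "u @ [Sep] = c @ a # u'" "blocks us = c @ v'"
    "a \<noteq> hd (v' @ [Blank])" "Sep \<notin> set c" "set c \<subseteq> set u" by blast
  have cb: "Blank \<notin> set c" using c(5) assms(1) by auto
  \<comment> \<open>As \<open>c\<close> is free of \<open>Sep\<close>, the closing separator lies in
    the unread rest; \<open>d\<close> is empty when the mismatch occurs at the separator
    itself.\<close>
  obtain d where d: "a # u' = d @ [Sep]" "u = c @ d"
    using c(1,4) by (cases "a # u'" rule: rev_cases) auto
  have a: "a \<noteq> Blank" using d assms(1) by (cases d) auto
  have sc: "a \<noteq> scanned (tape_at (r @ c) v' z)" using c(3) by (cases v') auto
  have x: "tape_at p (u @ Sep # q) 0 = tape_at p (c @ a # u' @ q) 0"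
    using c(1) by (metis append.assoc append_Cons append_Nil)
  have x2: "tape_at (p @ c) (d @ Sep # q) 0 = tape_at (p @ c) (a # u' @ q) 0"
    using d(1) by (metis append.assoc append_Cons append_Nil)
  have 1: "run (prog_step mark_blocks) (6, t, tape_at p (u @ Sep # q) 0, tape_at r (blocks us) z)
      (replicate (length c) Silent) (6, t, tape_at (p @ c) (d @ Sep # q) 0, tape_at (r @ c) v' z)"
    unfolding x x2 c(2) by (rule run_mark_compare[OF cb c(4)])
  have 2: "run (prog_step mark_blocks) (6, t, tape_at (p @ c) (d @ Sep # q) 0, tape_at (r @ c) v' z)
      [Silent] (9, t, tape_at (p @ c) (d @ Sep # q) 0, tape_at (r @ c) v' z)"
    unfolding x2 using a sc by (intro run_single) (simp add: prog_mark_blocks)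
  have 3: "run (prog_step mark_blocks) (9, t, tape_at (p @ c) (d @ Sep # q) 0, tape_at (r @ c) v' z)
      (replicate (length d) Silent @ [Put (Bit False)])
      (10, t, tape_at (p @ u @ [Sep]) q 0, move_head MoveL (tape_at (r @ c) v' z))"
    using run_mark_skip[of d t "p @ c" q "tape_at (r @ c) v' z"] d(2) assms(2) by simp
  have 4: "run (prog_step mark_blocks)
      (10, t, tape_at (p @ u @ [Sep]) q 0, move_head MoveL (tape_at (r @ c) v' z))
      (replicate (Suc (length c)) Silent) (6, t, tape_at (p @ u @ [Sep]) q 0, tape_at r (blocks us) z)"
    unfolding c(2) by (rule run_mark_back[OF cb c(4) assms(3)])
  show ?thesis
    using run_trans[OF run_trans[OF 1 2] run_trans[OF 3 4]] d(2)
    by (intro exI[of _ "(replicate (length c) Silent @ [Silent]) @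
      (replicate (length d) Silent @ [Put (Bit False)]) @ replicate (Suc (length c)) Silent"]) auto
qed

lemma run_mark_match:
  assumes "Blank \<notin> set u" "Sep \<notin> set u"
  shows "run (prog_step mark_blocks) (6, t, tape_at p (u @ Sep # q) 0, tape_at r (u @ Sep # v) z)
    (replicate (length u) Silent @ [Put (Bit True)])
    (6, t, tape_at (p @ u @ [Sep]) q 0, tape_at (r @ u @ [Sep]) v z)"
proof -
  have "run (prog_step mark_blocks) (6, t, tape_at (p @ u) (Sep # q) 0, tape_at (r @ u) (Sep # v) z)
    [Put (Bit True)] (6, t, tape_at (p @ u @ [Sep]) q 0, tape_at (r @ u @ [Sep]) v z)"
    by (rule run_single) (simp add: prog_mark_blocks)
  then show ?thesis using run_trans[OF run_mark_compare[OF assms]] by blast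
qed

text \<open>Selection preserves order, so greedy matching works. For a selected \<open>u\<close> the
  buffer continues with \<open>u\<close>; for an unselected one distinctness keeps \<open>u\<close>
  out of the remaining selection, so the comparison must fail.\<close>

lemma run_mark_blocks:
  assumes "length bs = length us" "\<forall>u \<in> set us. Blank \<notin> set u \<and> Sep \<notin> set u" "distinct us"
    and "r = [] \<or> last r = Sep"
  shows "\<exists>os. run (prog_step mark_blocks)
      (6, t, tape_at p (blocks us) 0, tape_at r (blocks (selected bs us)) z) os
      (7, t, move_head MoveL (tape_at (p @ blocks us) [] 0),
        move_head MoveL (tape_at (r @ blocks (selected bs us)) [] z)) \<and>
    Done \<notin> set os \<and> puts os = map Bit bs \<and> length os \<le> 6 * length (blocks us) + 1"
  using assms
proof (induction bs us arbitrary: p r rule: list_induct2)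
  case Nil
  then show ?case
    by (intro exI[of _ "[Silent]"]) (auto intro!: run_single simp: prog_mark_blocks act_scanned)
next
  case (Cons b bs u us)
  have u: "Blank \<notin> set u" "Sep \<notin> set u" using Cons.prems by auto
  let ?r = "if b then r @ u @ [Sep] else r"
  have "\<exists>os. run (prog_step mark_blocks)
      (6, t, tape_at p (blocks (u # us)) 0, tape_at r (blocks (selected (b # bs) (u # us))) z) os
      (6, t, tape_at (p @ u @ [Sep]) (blocks us) 0, tape_at ?r (blocks (selected bs us)) z) \<and>
    Done \<notin> set os \<and> puts os = [Bit b] \<and> length os \<le> 6 * length u + 6"
  proof (cases b)
    case True
    then show ?thesis
      using run_mark_match[OF u, of t p "blocks us" r "blocks (selected bs us)" z]
      by (intro exI[of _ "replicate (length u) Silent @ [Put (Bit True)]"]) auto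
  next
    case False
    have "\<forall>u' \<in> set (selected bs us). Sep \<notin> set u'" "u \<notin> set (selected bs us)"
      using Cons.prems set_selected_subset[of bs us] by auto
    then show ?thesis
      using run_mark_mismatch[OF u Cons.prems(3), of "selected bs us" t p "blocks us" z] False by simp
  qed
  then obtain os1 where os1: "run (prog_step mark_blocks)
      (6, t, tape_at p (blocks (u # us)) 0, tape_at r (blocks (selected (b # bs) (u # us))) z) os1
      (6, t, tape_at (p @ u @ [Sep]) (blocks us) 0, tape_at ?r (blocks (selected bs us)) z)"
    "Done \<notin> set os1" "puts os1 = [Bit b]" "length os1 \<le> 6 * length u + 6" by blast
  have r: "?r = [] \<or> last ?r = Sep" using Cons.prems by auto
  obtain os where os: "run (prog_step mark_blocks)
      (6, t, tape_at (p @ u @ [Sep]) (blocks us) 0, tape_at ?r (blocks (selected bs us)) z) os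
      (7, t, move_head MoveL (tape_at ((p @ u @ [Sep]) @ blocks us) [] 0),
        move_head MoveL (tape_at (?r @ blocks (selected bs us)) [] z))"
    "Done \<notin> set os" "puts os = map Bit bs" "length os \<le> 6 * length (blocks us) + 1"
    using Cons.IH[OF _ _ r, of "p @ u @ [Sep]"] Cons.prems by auto
  have "?r @ blocks (selected bs us) = r @ blocks (selected (b # bs) (u # us))" by simp
  then show ?case
    using run_trans[OF os1(1) os(1)] os1(2-) os(2-)
    by (intro exI[of _ "os1 @ os"]) auto
qed

lemma translates_mark_blocks:
  assumes "\<forall>u \<in> set us. Blank \<notin> set u \<and> Sep \<notin> set u" "length bs = length us" "distinct us"
    and "9 * length (blocks us) + 4 \<le> K"
  shows "translates mark_blocks (blocks us) K (blocks (selected bs us)) (map Bit bs)"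
proof -
  let ?w = "blocks (selected bs us)"
  have "core_translates mark_blocks (blocks us) ?w (map Bit bs) (6 * length (blocks us) + 1)"
    using run_mark_blocks[OF assms(2,1,3), of "[]" _ "[]"] by (simp add: core_translates_def)
  moreover have "Blank \<notin> set (blocks us)" "Blank \<notin> set ?w"
    using assms(1) set_selected_subset[of bs us] by (auto simp: blocks_def)
  ultimately have "translates mark_blocks (blocks us)
      (6 * length (blocks us) + 1 + 2 * length ?w + length (blocks us) + 3) ?w (map Bit bs)"
    by (rule core_translates_imp_translates)
  \<comment> \<open>The buffered selection is no longer than the copy, whence 6 + 2 + 1 = 9.\<close>
  moreover have "6 * length (blocks us) + 1 + 2 * length ?w + length (blocks us) + 3 \<le> K"
    using assms(4) length_blocks_selected[of bs us] by simp
  ultimately show ?thesis unfolding translates_def by (meson order_trans)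
qed


section \<open>Maximal signatures and maximal red-blue bipartite subgraphs\<close>

text \<open>Reading membership in \<open>X\<close> as the truth value, an edge crosses the
  bipartition exactly when its two variables get different values.\<close>

lemma cut_iff_differ_iff_holds:
  assumes "card (clause_vars C) = 2" "clause_vars C \<subseteq> X \<union> Y" "X \<inter> Y = {}"
  shows "((\<exists>x \<in> X. \<exists>y \<in> Y. clause_vars C = {x, y}) \<longleftrightarrow> is_differ C) \<longleftrightarrow> holds (\<lambda>v. v \<in> X) C"
proof -
  obtain u v where uv: "clause_vars C = {u, v}" "C = Equal u v \<or> C = Differ u v"
    by (cases C) auto
  have "u \<noteq> v" using assms(1) uv(1) by auto
  have "(\<exists>x \<in> X. \<exists>y \<in> Y. {u, v} = {x, y}) \<longleftrightarrow> (u \<in> X) \<noteq> (v \<in> X)"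
    using assms(2,3) uv(1) by (auto simp: doubleton_eq_iff)
  then show ?thesis using uv by auto
qed

lemma red_blue_bipartite_imp_holds:
  assumes "graphic \<phi>" "is_subgraph (graph_of \<phi>) (V, F)" "red_blue_bipartite (graph_of \<phi>) (V, F)"
  shows "\<exists>a. \<forall>j \<in> F. holds a (\<phi> ! j)"
proof -
  have F: "j < length \<phi>" "clause_vars (\<phi> ! j) \<subseteq> V" "card (clause_vars (\<phi> ! j)) = 2" if "j \<in> F" for j
    using assms(1,2) that by (auto simp: is_subgraph_def graph_of_def graphic_def)
  obtain X Y where XY: "X \<union> Y = V" "X \<inter> Y = {}"
    and cut: "{e \<in> F. \<exists>x \<in> X. \<exists>y \<in> Y. clause_vars (\<phi> ! e) = {x, y}} =
              F \<inter> {j. j < length \<phi> \<and> is_differ (\<phi> ! j)}"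
    using assms(3) by (auto simp: red_blue_bipartite_def graph_of_def)
  have "holds (\<lambda>v. v \<in> X) (\<phi> ! j)" if "j \<in> F" for j
  proof -
    have "(\<exists>x \<in> X. \<exists>y \<in> Y. clause_vars (\<phi> ! j) = {x, y}) \<longleftrightarrow> is_differ (\<phi> ! j)"
      using cut that F(1) by blast
    then show ?thesis
      using cut_iff_differ_iff_holds[of "\<phi> ! j" X Y] F[OF that] XY by simp
  qed
  then show ?thesis by blast
qed

text \<open>The two sides are the true and the false variables; using all vertices costs nothing,
  since the bipartition condition concerns edges only.\<close>

lemma holds_imp_red_blue_bipartite:
  assumes "graphic \<phi>" "F \<subseteq> {..<length \<phi>}" "\<forall>j \<in> F. holds a (\<phi> ! j)"
  shows "is_subgraph (graph_of \<phi>) (cnf_vars \<phi>, F)"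
    and "red_blue_bipartite (graph_of \<phi>) (cnf_vars \<phi>, F)"
proof -
  have F: "clause_vars (\<phi> ! j) \<subseteq> cnf_vars \<phi>" "card (clause_vars (\<phi> ! j)) = 2" if "j \<in> F" for j
    using assms(1,2) that by (auto simp: cnf_vars_def graphic_def subset_iff)
  then show "is_subgraph (graph_of \<phi>) (cnf_vars \<phi>, F)"
    using assms(2) by (auto simp: is_subgraph_def graph_of_def)
  let ?X = "{v \<in> cnf_vars \<phi>. a v}" and ?Y = "{v \<in> cnf_vars \<phi>. \<not> a v}"
  have "(\<exists>x \<in> ?X. \<exists>y \<in> ?Y. clause_vars (\<phi> ! j) = {x, y}) \<longleftrightarrow> is_differ (\<phi> ! j)" if "j \<in> F" for j
  proof -
    have "holds (\<lambda>v. v \<in> ?X) (\<phi> ! j)"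
      using assms(3) F(1)[OF that] that by (cases "\<phi> ! j") auto
    then show ?thesis
      using cut_iff_differ_iff_holds[of "\<phi> ! j" ?X ?Y] F[OF that] by fastforce
  qed
  then have "{e \<in> F. \<exists>x \<in> ?X. \<exists>y \<in> ?Y. ends (graph_of \<phi>) e = {x, y}} = F \<inter> blue (graph_of \<phi>)"
    using assms(2) unfolding graph_of_def by auto
  then show "red_blue_bipartite (graph_of \<phi>) (cnf_vars \<phi>, F)"
    unfolding red_blue_bipartite_def by (intro exI[of _ ?X] exI[of _ ?Y]) auto
qed

definition signature_subgraph :: "cnf \<Rightarrow> bool list \<Rightarrow> (nat, nat) subgraph" where
  "signature_subgraph \<phi> s = (cnf_vars \<phi>, {j. j < length \<phi> \<and> s ! j})"

lemma signature_le_iff: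
  "bitwise_le (signature \<phi> a) (signature \<phi> b) \<longleftrightarrow>
     (\<forall>j < length \<phi>. holds a (\<phi> ! j) \<longrightarrow> holds b (\<phi> ! j))"
  by (auto simp: bitwise_le_def signature_def list_all2_conv_all_nth)

lemma signature_eq_iff:
  "signature \<phi> a = signature \<phi> b \<longleftrightarrow> (\<forall>j < length \<phi>. holds a (\<phi> ! j) \<longleftrightarrow> holds b (\<phi> ! j))"
  by (auto simp: signature_def list_eq_iff_nth_eq)

lemma signature_subgraph_signature:
  "signature_subgraph \<phi> (signature \<phi> a) = (cnf_vars \<phi>, {j. j < length \<phi> \<and> holds a (\<phi> ! j)})"
  by (auto simp: signature_subgraph_def signature_def)

lemma bij_betw_signature_subgraph:
  assumes g: "graphic \<phi>"
  shows "bij_betw (signature_subgraph \<phi>) (maximal_signatures \<phi>)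
    (maximal_red_blue_bipartite_subgraphs (graph_of \<phi>))"
proof -
  let ?G = "graph_of \<phi>" and ?F = "\<lambda>a. {j. j < length \<phi> \<and> holds a (\<phi> ! j)}"
  have F: "?F a \<subseteq> {..<length \<phi>}" "\<forall>j \<in> ?F a. holds a (\<phi> ! j)" for a by auto
  note sub = holds_imp_red_blue_bipartite[OF g F]
  have "inj_on (signature_subgraph \<phi>) (maximal_signatures \<phi>)"
  proof (rule inj_onI)
    fix s t assume "s \<in> maximal_signatures \<phi>" "t \<in> maximal_signatures \<phi>"
      and eq: "signature_subgraph \<phi> s = signature_subgraph \<phi> t"
    then obtain a b where "s = signature \<phi> a" "t = signature \<phi> b"
      by (auto simp: maximal_signatures_def signatures_def)
    then show "s = t"
      using eq by (simp add: signature_subgraph_signature signature_eq_iff set_eq_iff) blast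
  qed
  moreover have "signature_subgraph \<phi> s \<in> maximal_red_blue_bipartite_subgraphs ?G"
    if s: "s \<in> maximal_signatures \<phi>" for s
  proof -
    obtain a where a: "s = signature \<phi> a" using s by (auto simp: maximal_signatures_def signatures_def)
    have "\<not> ?F a \<subset> F'" if H': "is_subgraph ?G (V', F')" "red_blue_bipartite ?G (V', F')" for V' F'
    proof
      assume less: "?F a \<subset> F'"
      obtain b where b: "\<forall>j \<in> F'. holds b (\<phi> ! j)"
        using red_blue_bipartite_imp_holds[OF g H'] by blast
      have "F' \<subseteq> {..<length \<phi>}" using H'(1) by (auto simp: is_subgraph_def graph_of_def)
      \<comment> \<open>Enlarging \<open>F'\<close> to all clauses satisfied by \<open>b\<close>
        turns the comparison of edge sets into one of signatures.\<close>
      then have F': "F' \<subseteq> ?F b" using b by auto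
      then have "bitwise_le s (signature \<phi> b)"
        using less unfolding a signature_le_iff by blast
      then have "signature \<phi> b = signature \<phi> a"
        using s a by (auto simp: maximal_signatures_def signatures_def)
      then have "?F b = ?F a" by (auto simp: signature_eq_iff)
      then show False using F' less by blast
    qed
    then show ?thesis
      using sub[of a] unfolding a signature_subgraph_signature maximal_red_blue_bipartite_subgraphs_def
      by auto
  qed
  moreover have "H \<in> signature_subgraph \<phi> ` maximal_signatures \<phi>"
    if H: "H \<in> maximal_red_blue_bipartite_subgraphs ?G" for H
  proof -
    \<comment> \<open>Maximality speaks about edges only; that \<open>H\<close> is spanning fixes
      its vertex set, so that \<open>H\<close> can be recovered from a signature.\<close>
    obtain F where HF: "H = (cnf_vars \<phi>, F)"
      using maximal_subgraph_spanning[OF g H] by (cases H) (auto simp: graph_of_def)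
    have F: "is_subgraph ?G (cnf_vars \<phi>, F)" "red_blue_bipartite ?G (cnf_vars \<phi>, F)"
      and max: "\<And>b. \<not> F \<subset> ?F b"
      using H sub unfolding HF maximal_red_blue_bipartite_subgraphs_def by auto
    obtain a where a: "\<forall>j \<in> F. holds a (\<phi> ! j)"
      using red_blue_bipartite_imp_holds[OF g F] by blast
    moreover have "F \<subseteq> {..<length \<phi>}" using F(1) by (auto simp: is_subgraph_def graph_of_def)
    ultimately have Fa: "F = ?F a" using max[of a] by auto
    have "signature \<phi> b = signature \<phi> a" if "bitwise_le (signature \<phi> a) (signature \<phi> b)" for b
      using that max[of b] unfolding Fa signature_le_iff signature_eq_iff by blast
    then have "signature \<phi> a \<in> maximal_signatures \<phi>"
      by (auto simp: maximal_signatures_def signatures_def)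
    moreover have "H = signature_subgraph \<phi> (signature \<phi> a)"
      using HF Fa by (simp only: signature_subgraph_signature)
    ultimately show ?thesis by blast
  qed
  ultimately show ?thesis
    unfolding bij_betw_def by (intro conjI subset_antisym image_subsetI subsetI)
qed


section \<open>Encodings as blocks\<close>

lemma set_bin: "set (bin n) \<subseteq> range Bit"
proof (induction n rule: less_induct)
  case (less n)
  show ?case
  proof (cases "n < 2")
    case True
    then show ?thesis by (simp add: bin.simps[of n])
  next
    case False
    then show ?thesis using less[of "n div 2"] by (simp add: bin.simps[of n])
  qed
qed

text \<open>The last symbol gives the parity and the rest is the numeral of the half. The rest is
  empty only for numbers below 2, because no numeral is empty.\<close>

lemma bin_inj: "bin m = bin n \<Longrightarrow> m = n"
proof (induction m arbitrary: n rule: less_induct)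
  case (less m)
  have ne: "bin k \<noteq> []" for k by (simp add: bin.simps[of k])
  have m: "bin m = (if m < 2 then [] else bin (m div 2)) @ [Bit (odd m)]"
    and n: "bin n = (if n < 2 then [] else bin (n div 2)) @ [Bit (odd n)]"
    by (simp_all add: bin.simps[of m] bin.simps[of n])
  have par: "odd m = odd n" and
    hi: "(if m < 2 then [] else bin (m div 2)) = (if n < 2 then [] else bin (n div 2))"
    using less.prems unfolding m n by auto
  have "m div 2 = n div 2"
  proof (cases "m < 2")
    case True
    then show ?thesis using hi ne[of "n div 2"] by (auto split: if_splits)
  next
    case False
    then have "bin (m div 2) = bin (n div 2)" using hi ne[of "m div 2"] by (auto split: if_splits)
    then show ?thesis using less.IH[of "m div 2" "n div 2"] False by simp
  qed
  moreover have "m mod 2 = n mod 2" using par by (simp add: parity_cases mod2_eq_if)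
  ultimately show ?case by (metis div_mult_mod_eq)
qed

fun clause_word :: "clause \<Rightarrow> symbol list" where
  "clause_word (Equal x y) = bin x @ EqSym # bin y"
| "clause_word (Differ x y) = bin x @ NeqSym # bin y"

lemma enc_clause_word: "enc_clause = (\<lambda>C. clause_word C @ [Sep])"
proof
  fix C
  show "enc_clause C = clause_word C @ [Sep]" by (cases C) auto
qed

lemma set_clause_word: "set (clause_word C) \<subseteq> range Bit \<union> {EqSym, NeqSym}"
proof (cases C)
  case (Equal x y)
  then show ?thesis using set_bin[of x] set_bin[of y] by auto
next
  case (Differ x y)
  then show ?thesis using set_bin[of x] set_bin[of y] by auto
qed

lemma append_Cons_eq_split:
  assumes "xs @ a # ys = xs' @ a' # ys'" "a \<notin> set xs'" "a' \<notin> set xs"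
  shows "xs = xs' \<and> a = a' \<and> ys = ys'"
  using assms
proof (induction xs arbitrary: xs')
  case Nil
  then show ?case by (cases xs') auto
next
  case (Cons b xs)
  then show ?case by (cases xs') auto
qed

text \<open>Numerals consist of bits, so the relation symbol marks a unique splitting point and
  reveals the kind of the clause.\<close>

lemma clause_word_inj: "clause_word C = clause_word D \<Longrightarrow> C = D"
proof -
  assume eq: "clause_word C = clause_word D"
  have b: "EqSym \<notin> set (bin k)" "NeqSym \<notin> set (bin k)" for k
    using set_bin[of k] by auto
  show "C = D"
    using eq by (cases C; cases D) (auto dest!: append_Cons_eq_split simp: b dest: bin_inj)
qed

lemma enc_cnf_blocks: "enc_cnf \<phi> = blocks (map clause_word \<phi>)"
  by (simp add: enc_cnf_def blocks_def enc_clause_word o_def)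

lemma nths_eq_selected:
  "length s = length xs \<Longrightarrow> nths xs {j. j < length xs \<and> s ! j} = selected s xs"
  by (induction s xs rule: list_induct2) (auto simp: nths_Cons)

lemma selected_map: "length s = length xs \<Longrightarrow> selected s (map f xs) = map f (selected s xs)"
  by (induction s xs rule: list_induct2) auto

lemma enc_signature_subgraph:
  assumes "length s = length \<phi>"
  shows "enc_subgraph \<phi> (signature_subgraph \<phi> s) = blocks (selected s (map clause_word \<phi>))"
  using assms
  by (simp add: enc_subgraph_def signature_subgraph_def nths_eq_selected selected_map blocks_def
    enc_clause_word o_def)

lemma length_maximal_signature: "s \<in> maximal_signatures \<phi> \<Longrightarrow> length s = length \<phi>"
  by (auto simp: maximal_signatures_def signatures_def signature_def)

lemma clause_words_block_free: "\<forall>u \<in> set (map clause_word \<phi>). Blank \<notin> set u \<and> Sep \<notin> set u"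
  using set_clause_word by fastforce

lemma set_enc_cnf: "set (enc_cnf \<phi>) \<subseteq> range Bit \<union> {EqSym, NeqSym, Sep}"
proof -
  have "set (clause_word C @ [Sep]) \<subseteq> range Bit \<union> {EqSym, NeqSym, Sep}" for C
    using set_clause_word[of C] by auto
  then show ?thesis
    unfolding enc_cnf_def enc_clause_word set_concat set_map by blast
qed

text \<open>Clauses that differ as equations also differ as terms, and a clause can be read off its
  word.\<close>

lemma distinct_clause_words: "graphic \<phi> \<Longrightarrow> distinct (map clause_word \<phi>)"
  unfolding graphic_def by (auto simp: distinct_map inj_on_def dest: clause_word_inj)

theorem theorem4:
  shows "poly_delay_poly_space_enumerable {\<phi>. graphic \<phi>} enc_cnf
           maximal_signatures enc_signature
     \<longleftrightarrow>
         poly_delay_poly_space_enumerable {\<phi>. graphic \<phi>} enc_cnf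
           (\<lambda>\<phi>. maximal_red_blue_bipartite_subgraphs (graph_of \<phi>)) enc_subgraph"
    (is "?sig \<longleftrightarrow> ?sub")
proof
  assume ?sig
  then show ?sub
  proof (rule enumerable_translate[OF _ wf_select_blocks])
    fix \<phi> s
    assume "\<phi> \<in> {\<phi>. graphic \<phi>}" "s \<in> maximal_signatures \<phi>"
    then have "length s = length \<phi>" by (simp add: length_maximal_signature)
    then show "translates select_blocks (enc_cnf \<phi>) (poly [:4, 4:] (length (enc_cnf \<phi>)))
        (enc_signature \<phi> s) (enc_subgraph \<phi> (signature_subgraph \<phi> s))"
      unfolding enc_cnf_blocks enc_signature_def
      by (subst enc_signature_subgraph, simp,
          intro translates_select_blocks[OF clause_words_block_free]) auto
  qed (rule set_enc_cnf, simp add: bij_betw_signature_subgraph)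
next
  assume ?sub
  then show ?sig
  proof (rule enumerable_translate[OF _ wf_mark_blocks])
    fix \<phi>
    assume "\<phi> \<in> {\<phi>. graphic \<phi>}"
    then show "bij_betw (inv_into (maximal_signatures \<phi>) (signature_subgraph \<phi>))
        (maximal_red_blue_bipartite_subgraphs (graph_of \<phi>)) (maximal_signatures \<phi>)"
      by (simp add: bij_betw_inv_into bij_betw_signature_subgraph)
  next
    fix \<phi> H
    let ?s = "inv_into (maximal_signatures \<phi>) (signature_subgraph \<phi>) H"
    assume "\<phi> \<in> {\<phi>. graphic \<phi>}" and H: "H \<in> maximal_red_blue_bipartite_subgraphs (graph_of \<phi>)"
    then have g: "graphic \<phi>" by simp
    have im: "signature_subgraph \<phi> ` maximal_signatures \<phi> =
        maximal_red_blue_bipartite_subgraphs (graph_of \<phi>)"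
      using bij_betw_signature_subgraph[OF g] by (simp add: bij_betw_def)
    have len: "length ?s = length \<phi>"
      using H im by (intro length_maximal_signature inv_into_into) simp
    \<comment> \<open>With \<open>H\<close> written as the subgraph of its signature, its encoding
      becomes a list of selected blocks, the form that \<open>mark_blocks\<close> handles.\<close>
    have Hs: "H = signature_subgraph \<phi> ?s"
      using H im by (simp add: f_inv_into_f)
    have "translates mark_blocks (blocks (map clause_word \<phi>)) (poly [:4, 9:] (length (enc_cnf \<phi>)))
        (blocks (selected ?s (map clause_word \<phi>))) (map Bit ?s)"
      using len distinct_clause_words[OF g]
      by (intro translates_mark_blocks[OF clause_words_block_free]) (auto simp: enc_cnf_blocks)
    then show "translates mark_blocks (enc_cnf \<phi>) (poly [:4, 9:] (length (enc_cnf \<phi>)))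
        (enc_subgraph \<phi> H) (enc_signature \<phi> ?s)"
      using enc_signature_subgraph[OF len] Hs by (simp add: enc_signature_def enc_cnf_blocks)
  qed (rule set_enc_cnf)
qed

end
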